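(* Let $q$ be a prime power and $n\ge 3$. Embed $\mathrm{AG}(n,q)$ in $\mathrm{PG}(n,q)$ with hyperplane at infinity $H_\infty$. Let $U\subseteq\mathrm{AG}(n,q)$ with $|U|=q^{n-1}-2$, let $D\subseteq H_\infty$ be the set of directions determined by $U$, and let $N=H_\infty\setminus D$ be the set of non-determined directions. Then at least one of the following holds: (i) $U$ can be extended to a set $\bar U\supseteq U$ of affine points with $|\bar U|=q^{n-1}$ determining only directions in $D$; (ii) the points of $N$ are collinear and $|N|\le\lfloor (q+3)/2\rfloor$; (iii) the points of $N$ lie on a (planar) conic.
   Context: A direction $t\in H_\infty$ is determined by a set of affine points if some affine line through $t$ (a line of $\mathrm{PG}(n,q)$ through $t$ not contained in $H_\infty$) contains at least two points of the set.
   Formalization: The case q = 2, n = 3 is excluded: there |U| = 2 determines one direction, so N is a Fano plane minus a point, and none of (i), (ii), (iii) holds for any such U. *)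

theory Defs
  imports "HOL-Analysis.Analysis"
begin

(* PG(n,q) is the lattice of subspaces of 'a ^ 'm with CARD('a) = q and CARD('m) = n + 1:
   points are the 1-dimensional subspaces, lines the 2-dimensional ones, planes the
   3-dimensional ones, and incidence is inclusion. *)

definition pg_points :: "('a::field ^ 'm::finite) set set" where
  "pg_points = {P. vec.subspace P \<and> vec.dim P = 1}"

definition pg_lines :: "('a::field ^ 'm::finite) set set" where
  "pg_lines = {l. vec.subspace l \<and> vec.dim l = 2}"

definition pg_planes :: "('a::field ^ 'm::finite) set set" where
  "pg_planes = {W. vec.subspace W \<and> vec.dim W = 3}"

definition pg_hyperplanes :: "('a::field ^ 'm::finite) set set" where
  "pg_hyperplanes = {H. vec.subspace H \<and> vec.dim H + 1 = CARD('m)}"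

definition infinite_points :: "('a::field ^ 'm::finite) set \<Rightarrow> ('a ^ 'm) set set" where
  "infinite_points H = {P \<in> pg_points. P \<subseteq> H}"

(* The points of AG(n,q), embedded in PG(n,q) with hyperplane at infinity H. *)
definition affine_points :: "('a::field ^ 'm::finite) set \<Rightarrow> ('a ^ 'm) set set" where
  "affine_points H = {P \<in> pg_points. \<not> P \<subseteq> H}"

definition determined_directions ::
  "('a::field ^ 'm::finite) set \<Rightarrow> ('a ^ 'm) set set \<Rightarrow> ('a ^ 'm) set set" where
  "determined_directions H U =
     {t \<in> infinite_points H. \<exists>l \<in> pg_lines. t \<subseteq> l \<and> \<not> l \<subseteq> H \<and>
        (\<exists>P \<in> U. \<exists>R \<in> U. P \<noteq> R \<and> P \<subseteq> l \<and> R \<subseteq> l)}"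

definition pg_collinear :: "('a::field ^ 'm::finite) set set \<Rightarrow> bool" where
  "pg_collinear X \<longleftrightarrow> (\<exists>l \<in> pg_lines. \<forall>P \<in> X. P \<subseteq> l)"

definition polar_form :: "('v::plus \<Rightarrow> 'a::ab_group_add) \<Rightarrow> 'v \<Rightarrow> 'v \<Rightarrow> 'a" where
  "polar_form Q u v = Q (u + v) - Q u - Q v"

(* Valid in every characteristic. Linearity in the first argument suffices, as the polar
   form is symmetric. *)
definition quadratic_form_on ::
  "('a::field ^ 'm::finite) set \<Rightarrow> ('a ^ 'm \<Rightarrow> 'a) \<Rightarrow> bool" where
  "quadratic_form_on W Q \<longleftrightarrow>
     (\<forall>c. \<forall>v \<in> W. Q (c *s v) = c\<^sup>2 * Q v) \<and>
     (\<forall>u \<in> W. \<forall>v \<in> W. \<forall>w \<in> W. polar_form Q (u + v) w = polar_form Q u w + polar_form Q v w) \<and>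
     (\<forall>c. \<forall>u \<in> W. \<forall>w \<in> W. polar_form Q (c *s u) w = c * polar_form Q u w)"

(* The radical of the polar form alone would be the wrong condition: in characteristic 2 it
   is nonzero for every ternary form. Over a perfect field, such as a finite one, a ternary
   form is nonsingular in the present sense iff the curve Q = 0 is smooth. *)
definition nonsingular_on ::
  "('a::field ^ 'm::finite) set \<Rightarrow> ('a ^ 'm \<Rightarrow> 'a) \<Rightarrow> bool" where
  "nonsingular_on W Q \<longleftrightarrow>
     (\<forall>v \<in> W. Q v = 0 \<and> (\<forall>w \<in> W. polar_form Q v w = 0) \<longrightarrow> v = 0)"

definition planar_conic :: "('a::field ^ 'm::finite) set set \<Rightarrow> bool" where
  "planar_conic C \<longleftrightarrow>
     (\<exists>W \<in> pg_planes. \<exists>Q. quadratic_form_on W Q \<and> nonsingular_on W Q \<and>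
        C = {P \<in> pg_points. P \<subseteq> W \<and> (\<forall>v \<in> P. Q v = 0)})"

(* For q = 2 and n = 3 no set U of q ^ (n - 1) - 2 = 2 affine points satisfies any of the three
   alternatives: U determines a single direction, so N is a Fano plane minus a point. This is
   why that pair has to be excluded from the statement about sets of q ^ (n - 1) - 2 points. *)
lemma order_2_dim_3_fails:
  fixes H :: "('a::{field,finite} ^ 'm::finite) set"
    and U :: "('a ^ 'm) set set"
  assumes q: "CARD('a) = 2" and n: "CARD('m) = 4"
    and H: "H \<in> pg_hyperplanes" and U: "U \<subseteq> affine_points H" "card U = 2"
  defines "N \<equiv> infinite_points H - determined_directions H U"
  shows "\<not> (\<exists>U'. U \<subseteq> U' \<and> U' \<subseteq> affine_points H \<and> card U' = 4 \<and>
               determined_directions H U' \<subseteq> determined_directions H U)"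
    and "\<not> pg_collinear N"
    and "\<not> (\<exists>C. planar_conic C \<and> N \<subseteq> C)"
proof -
  have univ: "UNIV = {0, 1 :: 'a}"
    by (rule sym, rule card_subset_eq) (use q in auto)
  have sc: "c = 0 \<or> c = 1" for c :: 'a
    using univ by auto
  have two: "1 + 1 = (0 :: 'a)"
    using sc[of "1 + 1"] by (metis add_left_cancel add.right_neutral one_neq_zero)
  have two_s: "x + x = 0" for x :: 'a
    using sc[of x] two by auto
  have dbl: "x + x = 0" for x :: "'a ^ 'm"
    using two_s by (simp add: vec_eq_iff)
  have dbl': "x + (x + y) = y" for x y :: "'a ^ 'm"
    using dbl[of x] by (metis add.assoc add_0)
  have sum0: "x + y = 0 \<longleftrightarrow> x = y" for x y :: "'a ^ 'm"
    by (metis add_left_cancel dbl)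
  have span1: "vec.span {v} = {0, v}" for v :: "'a ^ 'm"
    unfolding vec.span_singleton univ by auto
  have pt_iff: "P \<in> pg_points \<longleftrightarrow> (\<exists>v. v \<noteq> 0 \<and> P = {0, v})" for P :: "('a ^ 'm) set"
  proof
    assume P: "P \<in> pg_points"
    then obtain B where B: "B \<subseteq> P" "vec.independent B" "P \<subseteq> vec.span B" "card B = 1"
      unfolding pg_points_def using vec.basis_exists[of P] by auto
    then obtain v where v: "B = {v}" by (auto simp: card_1_singleton_iff)
    have "P = vec.span B"
      using B P vec.span_minimal[of B P] unfolding pg_points_def by auto
    moreover have "v \<noteq> 0" using B(2) v vec.dependent_zero by auto
    ultimately show "\<exists>v. v \<noteq> 0 \<and> P = {0, v}" using v span1 by auto
  next
    assume "\<exists>v. v \<noteq> 0 \<and> P = {0, v}"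
    then obtain v where v: "v \<noteq> 0" "P = vec.span {v}" by (auto simp: span1)
    then show "P \<in> pg_points"
      unfolding pg_points_def by (auto simp: vec.subspace_span vec.dim_insert)
  qed
  have sH: "vec.subspace H" and dH: "vec.dim H = 3"
    using H n unfolding pg_hyperplanes_def by auto
  have H0: "0 \<in> H"
    using sH by (rule vec.subspace_0)
  have Hadd: "x + y \<in> H" if "x \<in> H" "y \<in> H" for x y
    using sH that by (rule vec.subspace_add)
  have span_ins: "x \<in> vec.span (insert a S) \<longleftrightarrow> x \<in> vec.span S \<or> x + a \<in> vec.span S"
    for x a :: "'a ^ 'm" and S
  proof -
    have "x - a = x + a" using dbl'[of a "x"] dbl[of a] by (metis add.commute add_diff_cancel add.assoc)
    moreover have "x \<in> vec.span (insert a S) \<longleftrightarrow> (\<exists>k. x - k *s a \<in> vec.span S)"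
      unfolding vec.span_insert by simp
    moreover have "\<dots> \<longleftrightarrow> x - 0 *s a \<in> vec.span S \<or> x - 1 *s a \<in> vec.span S"
      by (metis sc)
    ultimately show ?thesis by (metis vec.scale_one vec.scale_zero_left diff_zero)
  qed
  have sumH: "x + y \<in> H" if "x \<notin> H" "y \<notin> H" for x y
  proof -
    have sp: "vec.span H = H" using sH by simp
    have "x \<notin> vec.span H"
      using that sp by metis
    then have "vec.dim (insert x H) = 4"
      using dH by (simp only: vec.dim_insert) simp
    then have "vec.dim (UNIV :: ('a ^ 'm) set) \<le> vec.dim (insert x H)"
      using n vec_dim_card[where 'a = 'a and 'n = 'm] by linarith
    then have "vec.span (insert x H) = UNIV"
      using vec.dim_eq_span[of "insert x H" UNIV] by simp
    then have "y \<in> H \<or> y + x \<in> H" using span_ins[of y x H] sp by (metis UNIV_I)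
    with that show ?thesis by (simp add: add.commute)
  qed
  obtain P R where PR: "U = {P, R}" "P \<noteq> R" using U(2) by (auto simp: card_2_iff)
  have "P \<in> affine_points H" "R \<in> affine_points H" using U(1) PR by auto
  then obtain p r where p: "P = {0, p}" "p \<notin> H" and r: "R = {0, r}" "r \<notin> H"
    unfolding affine_points_def pt_iff using H0 by auto
  define d where "d = p + r"
  have d: "d \<in> H" unfolding d_def using sumH p r by auto
  have d0: "d \<noteq> 0" using sum0[of p r] p r PR unfolding d_def by auto
  have inl: "x = 0 \<or> x = d"
    if l: "l \<in> pg_lines" and "x \<in> l" "d \<in> l" "x \<in> H" "y \<in> l" "y \<notin> H" for l x y
  proof (rule ccontr)
    assume c: "\<not> (x = 0 \<or> x = d)"
    have "x \<notin> vec.span {d}" using c span1 by auto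
    moreover have "y \<notin> vec.span {x, d}"
      using vec.span_minimal[of "{x, d}" H] sH that d by auto
    ultimately have "vec.dim {y, x, d} = 3"
      using d0 by (simp add: vec.dim_insert)
    moreover have "vec.dim {y, x, d} \<le> vec.dim l" by (rule vec.dim_subset) (use that in auto)
    ultimately show False using l unfolding pg_lines_def by auto
  qed
  have Nmem: "{0, x} \<in> N" if x: "x \<in> H" "x \<noteq> 0" "x \<noteq> d" for x
  proof -
    have "{0, x} \<in> infinite_points H"
      unfolding infinite_points_def pt_iff using x H0 by auto
    moreover have "{0, x} \<notin> determined_directions H U"
    proof
      assume "{0, x} \<in> determined_directions H U"
      then obtain l where l: "l \<in> pg_lines" "x \<in> l" "P \<subseteq> l" "R \<subseteq> l"
        unfolding determined_directions_def PR by auto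
      have "d \<in> l" unfolding d_def
        using l p r unfolding pg_lines_def by (auto intro: vec.subspace_add)
      with inl[of l x p] l x p show False by auto
    qed
    ultimately show ?thesis unfolding N_def by auto
  qed
  have Dmem: "x = d" if x: "{0, x} \<in> determined_directions H U" for x
    using Nmem[of x] x unfolding N_def determined_directions_def infinite_points_def pt_iff
    by (auto simp: doubleton_eq_iff)

  obtain B where B: "{d} \<subseteq> B" "B \<subseteq> H" "vec.independent B" "H \<subseteq> vec.span B"
    using vec.maximal_independent_subset_extend[of "{d}" H] d d0 by auto
  have "card B = 3" using vec.basis_card_eq_dim[of B H] B dH by auto
  then have "card (B - {d}) = 2" using B(1) by simp
  then obtain a b where "B - {d} = {a, b}" "a \<noteq> b" by (auto simp: card_2_iff)
  then have Bab: "B = {a, b, d}" "a \<noteq> b" "a \<noteq> d" "b \<noteq> d" using B(1) by auto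
  have ab: "a \<in> H" "b \<in> H" using Bab B by auto
  have nb: "b \<notin> vec.span {d}"
  proof -
    have "vec.independent (insert b {d})"
      using vec.independent_mono[OF B(3), of "{b, d}"] Bab by auto
    then show ?thesis using vec.independent_insert[of b "{d}"] Bab by auto
  qed
  have na: "a \<notin> vec.span {b, d}"
    using B(3) vec.independent_insert[of a "{b, d}"] Bab by auto
  have nz: "b \<noteq> 0" "a \<noteq> 0" "a + b \<noteq> 0" "a + b \<noteq> d" "a + d \<noteq> 0" "a + d \<noteq> d"
      "b + d \<noteq> 0" "b + d \<noteq> d" "a + b + d \<noteq> 0" "a + b + d \<noteq> d"
    using na nb Bab dbl by (auto simp: span_ins span1 add.assoc sum0)
  have "{{0, a}, {0, b}, {0, a + b}, {0, a + d}, {0, b + d}, {0, a + b + d}} \<subseteq> N"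
    using Nmem nz ab d Hadd Bab by auto
  then have N6: "{0, a} \<in> N" "{0, b} \<in> N" "{0, a + b} \<in> N" "{0, a + d} \<in> N"
      "{0, b + d} \<in> N" "{0, a + b + d} \<in> N"
    by auto
  have dim3: "vec.dim {a, b, d} = 3" using na nb d0 by (simp add: vec.dim_insert)
  have in_sub: "{a, b, d} \<subseteq> l" if "vec.subspace l" "a \<in> l" "b \<in> l" "b + d \<in> l" for l
    using that vec.subspace_add[of l b "b + d"] dbl'[of b d] by simp

  show "\<not> (\<exists>U'. U \<subseteq> U' \<and> U' \<subseteq> affine_points H \<and> card U' = 4 \<and>
               determined_directions H U' \<subseteq> determined_directions H U)"
  proof
    assume "\<exists>U'. U \<subseteq> U' \<and> U' \<subseteq> affine_points H \<and> card U' = 4 \<and>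
               determined_directions H U' \<subseteq> determined_directions H U"
    then obtain U' where U': "U \<subseteq> U'" "U' \<subseteq> affine_points H" "card U' = 4"
      "determined_directions H U' \<subseteq> determined_directions H U" by blast
    have "\<not> U' \<subseteq> U" using U'(1,3) U(2) by auto
    then obtain S where S: "S \<in> U'" "S \<noteq> P" "S \<noteq> R" using PR by auto
    then obtain s where s: "S = {0, s}" "s \<notin> H" 
      using U'(2) H0 unfolding affine_points_def pt_iff by auto
    have sp: "s \<noteq> p" using S s p by auto
    have e: "p + s \<in> H" "p + s \<noteq> 0" using sumH p s sp sum0[of p s] by auto
    have "vec.dim {p, s} = 2"
    proof -
      have "p \<notin> vec.span {s}" "s \<noteq> 0" using span1 sp p s H0 by auto
      then show ?thesis by (simp add: vec.dim_insert)
    qed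
    then have l: "vec.span {p, s} \<in> pg_lines" unfolding pg_lines_def by auto
    have "{0, p + s} \<in> determined_directions H U'"
      unfolding determined_directions_def
    proof (intro CollectI conjI bexI)
      show "{0, p + s} \<in> infinite_points H"
        unfolding infinite_points_def pt_iff using e H0 by auto
      show "{0, p + s} \<subseteq> vec.span {p, s}"
        by (auto intro: vec.span_add vec.span_base vec.span_zero)
      show "\<not> vec.span {p, s} \<subseteq> H" using p vec.span_base[of p "{p, s}"] by auto
      show "P \<noteq> S" using S by auto
      show "P \<subseteq> vec.span {p, s}" "S \<subseteq> vec.span {p, s}"
        using p s by (auto intro: vec.span_base vec.span_zero)
      show "P \<in> U'" "S \<in> U'" using U' PR S by auto
    qed (rule l)
    then have "p + s = d" using U'(4) Dmem by blast
    then have "s = r" unfolding d_def by simp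
    with s r S show False by auto
  qed

  show "\<not> pg_collinear N"
  proof
    assume "pg_collinear N"
    then obtain l where l: "l \<in> pg_lines" "\<forall>P \<in> N. P \<subseteq> l" unfolding pg_collinear_def by auto
    have "vec.subspace l" using l(1) unfolding pg_lines_def by simp
    moreover have "a \<in> l" "b \<in> l" "b + d \<in> l" using l(2) N6 by blast+
    ultimately have "{a, b, d} \<subseteq> l" by (rule in_sub)
    then show False using vec.dim_subset[of "{a, b, d}" l] dim3 l unfolding pg_lines_def by auto
  qed

  show "\<not> (\<exists>C. planar_conic C \<and> N \<subseteq> C)"
  proof
    assume "\<exists>C. planar_conic C \<and> N \<subseteq> C"
    then obtain W Q where W: "vec.subspace W" "vec.dim W = 3" and Q: "quadratic_form_on W Q"
      "nonsingular_on W Q" and NW: "\<And>P. P \<in> N \<Longrightarrow> P \<subseteq> W \<and> (\<forall>v \<in> P. Q v = 0)"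
      unfolding planar_conic_def pg_planes_def by blast
    have "a \<in> W" "b \<in> W" "b + d \<in> W" using NW N6 by blast+
    then have abd: "{a, b, d} \<subseteq> W" by (rule in_sub[OF W(1)])
    have z: "Q a = 0" "Q b = 0" "Q (a + b) = 0" "Q (a + d) = 0" "Q (b + d) = 0"
        "Q (a + b + d) = 0"
      using N6 NW by blast+
    have sym: "polar_form Q u v = polar_form Q v u" for u v
      unfolding polar_form_def by (simp add: add.commute)
    have add: "polar_form Q (u + v) w = polar_form Q u w + polar_form Q v w"
      if "u \<in> W" "v \<in> W" "w \<in> W" for u v w
      using Q(1) that unfolding quadratic_form_on_def by auto
    have scale: "polar_form Q (c *s u) w = c * polar_form Q u w" if "u \<in> W" "w \<in> W" for c u w
      using Q(1) that unfolding quadratic_form_on_def by auto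
    have "polar_form Q (a + b) d = polar_form Q a d + polar_form Q b d"
      using add abd by auto
    then have Qd: "Q d = 0" unfolding polar_form_def using z two by auto
    have ba: "polar_form Q b a = 0" "polar_form Q d a = 0" "polar_form Q a a = 0"
      unfolding polar_form_def using z Qd dbl[of a] NW[OF N6(1)] by (auto simp: add.commute)
    have "W \<subseteq> vec.span {a, b, d}"
      using vec.card_ge_dim_independent[of "{a, b, d}" W] abd W(2) B(3) Bab by auto
    moreover have "polar_form Q w a = 0 \<and> w \<in> W" if "w \<in> vec.span {a, b, d}" for w
      using that
    proof (induction rule: vec.span_induct_alt)
      case base
      have "polar_form Q (0 *s a) a = 0 * polar_form Q a a" using scale abd by blast
      then show ?case using W(1) by (simp add: vec.subspace_0)
    next
      case (step c x y)
      then have "x \<in> W" "polar_form Q x a = 0" using abd ba by auto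
      then show ?case using step W(1) scale[of x a c] add[of "c *s x" y a] abd
        by (auto simp: vec.subspace_add vec.subspace_scale)
    qed
    ultimately have "\<forall>w \<in> W. polar_form Q a w = 0" using sym by auto
    then have "a = 0" using Q(2) z abd unfolding nonsingular_on_def by auto
    then show False using nz by simp
  qed
qed

end

theory Submission
  imports Defs
begin

text \<open>
  Identify the affine points with the vectors of \<open>H\<close>, and \<open>U\<close> with a set \<open>X\<close> of vectors. If \<open>t\<close> is not
  determined, then \<open>X\<close> is injective modulo \<open>t\<close> and misses exactly two classes \<open>a\<close>, \<open>b\<close> of \<open>H / t\<close>.
  For a functional \<open>y\<close> with \<open>y(t) = 0\<close> the first two elementary symmetric functions of the values
  of \<open>y\<close> on all classes vanish, so \<open>a + b = s\<close> and \<open>a b = Q\<close> hold on the annihilator of \<open>t\<close>, for a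
  vector \<open>s\<close> and a quadratic form \<open>Q\<close> on the dual space that depend only on \<open>X\<close> (they are read off
  the two leading coefficients of the Redei polynomial).

  Fix a non-determined \<open>t0\<close> and move the origin to one of its missing classes. Then \<open>Q\<close> vanishes on
  the annihilator of \<open>t0\<close>, that is, \<open>Q = t0 w\<close>. For any other non-determined \<open>t\<close>, unique factorisation
  in \<open>t0 w = a (s - a)\<close> modulo \<open>t\<close> gives \<open>a = l t0\<close> and hence \<open>w - l s + l\<^sup>2 t0 = k t\<close> for scalars \<open>l\<close>,
  \<open>k\<close>. If \<open>s\<close>, \<open>t0\<close>, \<open>w\<close> are independent, then in these coordinates \<open>t\<close> is proportional to
  \<open>(-l, l\<^sup>2, 1)\<close>, which lies on a conic. If they are dependent, then either \<open>k = 0\<close> for some \<open>l\<close>, in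
  which case \<open>Q = l t0 (s - l t0)\<close> splits globally and its two factors are the points to be added to
  \<open>X\<close>, or every \<open>t\<close> lies on the line of \<open>s\<close> and \<open>t0\<close> and arises from two values of \<open>l\<close>.
\<close>

subsection \<open>Scalar products and quadratic forms\<close>

notation scalar_product (infixl "\<odot>" 70)

lemma scalar_product_commute: "x \<odot> y = y \<odot> (x :: 'a::comm_semiring_1 ^ 'm::finite)"
  by (simp add: scalar_product_def mult.commute)

lemma scalar_product_add_left: "(x + y) \<odot> z = x \<odot> z + y \<odot> (z :: 'a::semiring_1 ^ 'm::finite)"
  by (simp add: scalar_product_def algebra_simps sum.distrib)

lemma scalar_product_add_right: "z \<odot> (x + y) = z \<odot> x + z \<odot> (y :: 'a::semiring_1 ^ 'm::finite)"
  by (simp add: scalar_product_def algebra_simps sum.distrib)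

lemma scalar_product_scale_left: "(c *s x) \<odot> y = c * (x \<odot> (y :: 'a::semiring_1 ^ 'm::finite))"
  by (simp add: scalar_product_def sum_distrib_left mult.assoc)

lemma scalar_product_scale_right:
  "x \<odot> (c *s y) = c * (x \<odot> (y :: 'a::comm_semiring_1 ^ 'm::finite))"
  by (simp add: scalar_product_def sum_distrib_left mult_ac)

lemma scalar_product_diff_left: "(x - y) \<odot> z = x \<odot> z - y \<odot> (z :: 'a::ring_1 ^ 'm::finite)"
  by (simp add: scalar_product_def algebra_simps sum_subtractf)

lemma scalar_product_diff_right: "z \<odot> (x - y) = z \<odot> x - z \<odot> (y :: 'a::ring_1 ^ 'm::finite)"
  by (simp add: scalar_product_def algebra_simps sum_subtractf)

lemma scalar_product_minus_left: "(- x) \<odot> z = - (x \<odot> (z :: 'a::ring_1 ^ 'm::finite))"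
  by (simp add: scalar_product_def sum_negf)

lemma scalar_product_zero_left [simp]: "0 \<odot> (y :: 'a::semiring_1 ^ 'm::finite) = 0"
  by (simp add: scalar_product_def)

lemma scalar_product_sum_left:
  "(\<Sum>x\<in>A. f x) \<odot> (y :: 'a::semiring_1 ^ 'm::finite) = (\<Sum>x\<in>A. f x \<odot> y)"
  by (induction A rule: infinite_finite_induct) (simp_all add: scalar_product_add_left)

lemmas scalar_product_simps =
  scalar_product_add_left scalar_product_add_right scalar_product_scale_left
  scalar_product_scale_right scalar_product_diff_left scalar_product_diff_right
  scalar_product_minus_left

lemma functional_eq_scalar_product:
  fixes f :: "'a::field ^ 'm::finite \<Rightarrow> 'a"
  assumes "\<And>x y. f (x + y) = f x + f y" and "\<And>c x. f (c *s x) = c * f x"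
  shows "\<exists>w. \<forall>y. f y = w \<odot> y"
proof (intro exI allI)
  fix y
  have f0: "f 0 = 0" using assms(2)[of 0 0] by simp
  have "f (\<Sum>i\<in>A. y $ i *s axis i 1) = (\<Sum>i\<in>A. y $ i * f (axis i 1))" for A :: "'m set"
    by (induction A rule: infinite_finite_induct) (simp_all add: assms f0)
  from this[of UNIV] show "f y = (\<chi> i. f (axis i 1)) \<odot> y"
    by (simp add: basis_expansion scalar_product_def mult.commute)
qed

lemma separating_functional:
  fixes S :: "('a::field ^ 'm::finite) set"
  assumes "a \<notin> vec.span S"
  obtains y where "\<And>v. v \<in> vec.span S \<Longrightarrow> v \<odot> y = 0" "a \<odot> y = 1"
proof -
  obtain B where B: "B \<subseteq> S" "vec.independent B" "S \<subseteq> vec.span B"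
    using vec.maximal_independent_subset[of S] by auto
  have sp: "vec.span B = vec.span S"
    using B by (metis vec.span_mono vec.span_span subset_antisym)
  with assms have ind: "vec.independent (insert a B)" and aB: "a \<notin> B"
    using B vec.independent_insert[of a B] vec.span_base[of a B] by auto
  \<comment> \<open>The extension theorem is applied to maps with vector values, so the functional
    is taken to be one coordinate of such a map. Any index \<open>i\<close> serves.\<close>
  fix i :: 'm
  obtain g where g: "Vector_Spaces.linear (*s) (*s) g"
      "\<forall>x\<in>insert a B. g x = (if x = a then axis i 1 else (0 :: 'a ^ 'm))"
    using vec.linear_independent_extend[OF ind, of "\<lambda>x. if x = a then axis i 1 else 0"] by blast
  interpret g: Vector_Spaces.linear "(*s)" "(*s)" g by (rule g(1))
  obtain y where y: "\<forall>v. g v $ i = y \<odot> v"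
    using functional_eq_scalar_product[of "\<lambda>v. g v $ i"] by (auto simp: g.add g.scale)
  have "g v = 0" if "v \<in> vec.span S" for v
    using that unfolding sp[symmetric]
    by (rule g.eq_0_on_span[rotated]) (use g(2) aB in auto)
  moreover have "g a $ i = 1" using g(2) by simp
  ultimately show thesis
    using that[of y] y by (metis scalar_product_commute zero_index)
qed

text \<open>A vector space is not the union of two proper subspaces.\<close>

lemma mem_span_of_product_zero:
  fixes p r :: "'a::field ^ 'm::finite"
  assumes "\<And>y. (\<And>v. v \<in> S \<Longrightarrow> v \<odot> y = 0) \<Longrightarrow> (p \<odot> y) * (r \<odot> y) = 0"
  shows "p \<in> vec.span S \<or> r \<in> vec.span S"
proof (rule ccontr)
  assume "\<not> ?thesis"
  then obtain y z where
    y: "\<And>v. v \<in> vec.span S \<Longrightarrow> v \<odot> y = 0" "p \<odot> y = 1" and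
    z: "\<And>v. v \<in> vec.span S \<Longrightarrow> v \<odot> z = 0" "r \<odot> z = 1"
    using separating_functional by metis
  have "r \<odot> y = 0" using assms[of y] y vec.span_base by auto
  moreover have "p \<odot> z = 0" using assms[of z] z vec.span_base by auto
  ultimately show False
    using assms[of "y + z"] y z by (simp add: scalar_product_simps vec.span_base)
qed

lemma quadratic_form_on_mult:
  "quadratic_form_on W (\<lambda>y. (u \<odot> y) * (v \<odot> (y :: 'a::field ^ 'm::finite)))"
  unfolding quadratic_form_on_def polar_form_def
  by (auto simp: scalar_product_simps power2_eq_square algebra_simps)

lemma quadratic_form_on_add:
  assumes "quadratic_form_on W P" "quadratic_form_on W Q"
  shows "quadratic_form_on W (\<lambda>y. P y + Q y)"
proof -
  have "polar_form (\<lambda>y. P y + Q y) = (\<lambda>u v. polar_form P u v + polar_form Q u v)"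
    unfolding polar_form_def by (intro ext) simp
  with assms show ?thesis
    unfolding quadratic_form_on_def by (simp add: distrib_left add_ac)
qed

lemma quadratic_form_on_diff:
  assumes "quadratic_form_on W P" "quadratic_form_on W Q"
  shows "quadratic_form_on W (\<lambda>y. P y - Q y)"
proof -
  have "polar_form (\<lambda>y. P y - Q y) = (\<lambda>u v. polar_form P u v - polar_form Q u v)"
    unfolding polar_form_def by (intro ext) simp
  with assms show ?thesis
    unfolding quadratic_form_on_def by (simp add: right_diff_distrib)
qed

text \<open>Split \<open>y\<close> into a part in the kernel of \<open>t\<close>, where
  \<open>Q\<close> vanishes, and a multiple \<open>c\<close> of a fixed \<open>z\<close> outside the
  kernel. Every remaining term of \<open>Q y\<close> has the factor \<open>c\<close>, and
  \<open>c\<close> is the value of \<open>t\<close> at \<open>y\<close>.\<close>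

lemma quadratic_form_zero_on_hyperplane:
  fixes t :: "'a::field ^ 'm::finite"
  assumes Q: "quadratic_form_on UNIV Q" and t: "t \<noteq> 0"
    and zero: "\<And>y. t \<odot> y = 0 \<Longrightarrow> Q y = 0"
  shows "\<exists>w. \<forall>y. Q y = (t \<odot> y) * (w \<odot> y)"
proof -
  obtain z where z: "t \<odot> z = 1"
    using separating_functional[of t "{}"] t by auto
  have add: "polar_form Q (u + v) x = polar_form Q u x + polar_form Q v x"
    and scale: "polar_form Q (c *s u) x = c * polar_form Q u x"
    and sq: "Q (c *s u) = c\<^sup>2 * Q u" for c u v x
    using Q unfolding quadratic_form_on_def by auto
  \<comment> \<open>The cofactor of \<open>c\<close> in \<open>Q (x + c *s z)\<close>, with the
    polar form at \<open>x\<close> rewritten as the one at \<open>y\<close> so that \<open>f\<close>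
    is visibly linear in \<open>y\<close>.\<close>
  define f where "f y = polar_form Q y z + (t \<odot> y) * (Q z - polar_form Q z z)" for y
  have "\<exists>w. \<forall>y. f y = w \<odot> y"
    by (rule functional_eq_scalar_product)
      (auto simp: f_def add scale scalar_product_simps algebra_simps)
  moreover have "Q y = (t \<odot> y) * f y" for y
  proof -
    define c x where "c = t \<odot> y" and "x = y - c *s z"
    have y: "y = x + c *s z" unfolding x_def by simp
    have "Q x = 0" by (rule zero) (simp add: x_def c_def z scalar_product_simps)
    then have "Q y = polar_form Q (c *s z) x + c\<^sup>2 * Q z"
      unfolding y polar_form_def sq[symmetric] by (simp add: add.commute)
    also have "polar_form Q (c *s z) x = c * polar_form Q x z"
      unfolding scale by (simp add: polar_form_def add.commute)
    also have "polar_form Q x z = polar_form Q y z - c * polar_form Q z z"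
      unfolding y add scale by simp
    finally show ?thesis
      unfolding f_def c_def[symmetric] by (simp add: algebra_simps power2_eq_square)
  qed
  ultimately show ?thesis by auto
qed

subsection \<open>The classes missed modulo a non-determined direction\<close>

text \<open>For nonzero \<open>t\<close> in \<open>H\<close> and vectors representing affine points,
  this expresses that the direction of \<open>t\<close> is not determined; see
  \<open>determined_directions_iff\<close>.\<close>

definition inj_mod:: "'a::field ^ 'm::finite \<Rightarrow> ('a ^ 'm) set \<Rightarrow> bool" where
  "inj_mod t T \<longleftrightarrow> (\<forall>x\<in>T. \<forall>y\<in>T. x \<noteq> y \<longrightarrow> x - y \<notin> vec.span {t})"

lemma inj_on_inj_mod:
  assumes "t \<noteq> 0"
  shows "inj_on (\<lambda>(x, c). x + c *s t) (T \<times> UNIV) \<longleftrightarrow> inj_mod t T"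
proof
  assume inj: "inj_on (\<lambda>(x, c). x + c *s t) (T \<times> UNIV)"
  show "inj_mod t T"
    unfolding inj_mod_def
  proof (intro ballI impI notI)
    fix x y assume "x \<in> T" "y \<in> T" "x \<noteq> y" "x - y \<in> vec.span {t}"
    moreover from this obtain c where "x - y = c *s t"
      unfolding vec.span_singleton by blast
    then have "x = y + c *s t" by (simp add: algebra_simps)
    ultimately show False using inj_onD[OF inj, of "(x, 0)" "(y, c)"] by auto
  qed
next
  assume T: "inj_mod t T"
  have "x = y \<and> c = d" if "x \<in> T" "y \<in> T" "x + c *s t = y + d *s t" for x y c d
  proof -
    have "x - y = (d - c) *s t" using that(3) by (simp add: algebra_simps)
    then have "x = y" using T that(1,2) unfolding inj_mod_def vec.span_singleton by blast
    with that(3) assms show ?thesis by simp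
  qed
  then show "inj_on (\<lambda>(x, c). x + c *s t) (T \<times> UNIV)"
    by (auto intro!: inj_onI)
qed

text \<open>The classes modulo \<open>t\<close> that meet \<open>T\<close> contain only
  \<open>card T * CARD('a)\<close> vectors, so some vector of \<open>H\<close> lies in none of them
  and represents a new class.\<close>

lemma inj_mod_extend:
  fixes t :: "'a::{field,finite} ^ 'm::finite"
  assumes H: "vec.subspace H" and t: "t \<in> H" "t \<noteq> 0" and T: "T \<subseteq> H" "inj_mod t T"
    and card: "card T * CARD('a) < card H"
  shows "\<exists>a\<in>H - T. inj_mod t (insert a T)"
proof -
  let ?F = "(\<lambda>(x, c). x + c *s t) ` (T \<times> UNIV)"
  have fin: "finite (X :: ('a ^ 'm) set)" for X by simp
  have "card ?F = card (T \<times> (UNIV :: 'a set))"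
    by (rule card_image) (use inj_on_inj_mod[OF t(2), of T] T(2) in simp)
  then have "card ?F < card H" using card by (simp add: card_cartesian_product)
  then have "\<not> H \<subseteq> ?F" using card_mono[OF fin, of H ?F] by linarith
  then obtain a where a: "a \<in> H" "a \<notin> ?F" by blast
  have no: "a - x \<notin> vec.span {t}" if "x \<in> T" for x
  proof
    assume "a - x \<in> vec.span {t}"
    then obtain c where "a - x = c *s t" unfolding vec.span_singleton by blast
    then have "a = x + c *s t" by (simp add: algebra_simps)
    with a that show False by force
  qed
  have "x - a \<notin> vec.span {t}" if "x \<in> T" for x
    using no[OF that] vec.span_neg[of "x - a" "{t}"] by auto
  with no T(2) have "inj_mod t (insert a T)" unfolding inj_mod_def by auto
  moreover have "a \<notin> T" using no[of a] vec.span_zero by auto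
  ultimately show ?thesis using a by auto
qed

section \<open>Sums over the field and low coefficients of products of linear factors\<close>

lemma of_nat_CARD_eq_0: "of_nat CARD('a) = (0 :: 'a::{field,finite})"
proof -
  have "(\<Sum>x\<in>UNIV. x + 1) = (\<Sum>x\<in>UNIV. (x :: 'a))"
    by (rule sum.reindex_bij_witness[of _ "\<lambda>x. x - 1" "\<lambda>x. x + 1"]) auto
  then show ?thesis by (simp add: sum.distrib)
qed

lemma sum_UNIV_field_eq_0:
  assumes "CARD('a::{field,finite}) > 2"
  shows "(\<Sum>x\<in>UNIV. x) = (0 :: 'a)"
proof -
  have "\<not> (UNIV :: 'a set) \<subseteq> {0, 1}"
    using card_mono[of "{0, 1 :: 'a}" UNIV] assms by auto
  \<comment> \<open>Multiplication by \<open>k\<close> permutes the field, so the sum is fixed by a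
    factor other than 1. For two elements there is no such \<open>k\<close>, and the sum is
    1.\<close>
  then obtain k :: 'a where k: "k \<noteq> 0" "k \<noteq> 1" by auto
  have "(\<Sum>x\<in>UNIV. k * x) = (\<Sum>x\<in>UNIV. x)"
    by (rule sum.reindex_bij_witness[of _ "\<lambda>x. x / k" "\<lambda>x. k * x"]) (use k in auto)
  then have "(k - 1) * (\<Sum>x\<in>UNIV. x) = 0" by (simp add: sum_distrib_left left_diff_distrib sum_subtractf)
  with k show ?thesis by simp
qed

lemma coeff_linear_factor_mult:
  fixes c :: "'a::comm_ring_1"
  shows
  "coeff ([:1, c:] * p) 0 = coeff p (0 :: nat)"
  "coeff ([:1, c:] * p) (Suc n) = coeff p (Suc n) + c * coeff p n"
  by (simp_all add: add.commute)

text \<open>With factors of constant term 1, the coefficient of degree i is the i-th elementary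
  symmetric function of the values of \<open>f\<close>.\<close>

lemma coeff_prod_linear_factors_0: "coeff (\<Prod>x\<in>A. [:1, f x:]) 0 = (1 :: 'a::comm_ring_1)"
  by (induction A rule: infinite_finite_induct) (simp_all add: coeff_linear_factor_mult)

lemma coeff_prod_linear_factors_1:
  "coeff (\<Prod>x\<in>A. [:1, f x:]) (Suc 0) = (\<Sum>x\<in>A. f x :: 'a::comm_ring_1)"
  by (induction A rule: infinite_finite_induct)
    (simp_all add: coeff_linear_factor_mult coeff_prod_linear_factors_0 add.commute)

lemma coeff_power_1:
  assumes "coeff p 0 = (1 :: 'a::comm_ring_1)"
  shows "coeff (p ^ r) 0 = 1" "coeff (p ^ r) (Suc 0) = of_nat r * coeff p (Suc 0)"
  using assms by (induction r) (simp_all add: coeff_mult algebra_simps)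

text \<open>Degree 2 arises either from one factor contributing its quadratic term or from two
  factors contributing their linear terms.\<close>

lemma coeff_power_2:
  assumes "coeff p 0 = (1 :: 'a::comm_ring_1)"
  shows "coeff (p ^ r) 2 = of_nat r * coeff p 2 + of_nat (r choose 2) * (coeff p (Suc 0))\<^sup>2"
  using assms
  by (induction r)
    (simp_all add: coeff_mult coeff_power_1[OF assms] numeral_2_eq_2 algebra_simps)

text \<open>A new element \<open>x\<close> adds to the second elementary symmetric function the
  product of two linear forms: that of \<open>x\<close> and that of the sum of the earlier
  elements.\<close>

lemma quadratic_form_coeff_2:
  "quadratic_form_on UNIV (\<lambda>y. coeff (\<Prod>x\<in>A. [:1, x \<odot> (y :: 'a::field ^ 'm::finite):]) 2)"
proof (induction A rule: infinite_finite_induct)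
  case (insert x A)
  have "coeff (\<Prod>x\<in>insert x A. [:1, x \<odot> y:]) 2 =
      coeff (\<Prod>x\<in>A. [:1, x \<odot> y:]) 2 + (x \<odot> y) * ((\<Sum>x\<in>A. x) \<odot> y)" for y
    using insert(1,2)
    by (simp add: numeral_2_eq_2 coeff_linear_factor_mult coeff_prod_linear_factors_1
        scalar_product_sum_left del: mult_pCons_left)
  then show ?case
    using quadratic_form_on_add[OF insert(3) quadratic_form_on_mult] by simp
qed (auto simp: quadratic_form_on_def polar_form_def)

text \<open>The level sets of \<open>y\<close> in \<open>H\<close> are translates of each other
  along \<open>z\<close>, so each has a share of 1/q of \<open>H\<close>. Since \<open>y\<close>
  vanishes on \<open>t\<close>, each level set is a union of classes modulo \<open>t\<close>, which
  divides the count by q once more.\<close>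

lemma card_fibre_transversal:
  fixes t y :: "'a::{field,finite} ^ 'm::finite"
  assumes H: "vec.subspace H" "card H = CARD('a) ^ n" and n: "n \<ge> 2"
    and T: "bij_betw (\<lambda>(x, c). x + c *s t) (T \<times> UNIV) H"
    and y: "t \<odot> y = 0" and z: "z \<in> H" "z \<odot> y \<noteq> 0"
  shows "card {x \<in> T. x \<odot> y = c} = CARD('a) ^ (n - 2)"
proof -
  let ?q = "CARD('a)"
  let ?fib = "\<lambda>c. {v \<in> H. v \<odot> y = c}"
  have fin: "finite (X :: ('a ^ 'm) set)" for X by simp
  have shift: "card (?fib d) = card (?fib 0)" for d
  proof (rule bij_betw_same_card)
    let ?w = "(d / (z \<odot> y)) *s z"
    have w: "?w \<in> H" using H(1) z(1) by (simp add: vec.subspace_scale)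
    show "bij_betw (\<lambda>v. v - ?w) (?fib d) (?fib 0)"
      by (rule bij_betw_byWitness[where f' = "\<lambda>v. v + ?w"])
        (use w H(1) z(2) in \<open>auto simp: scalar_product_simps vec.subspace_add vec.subspace_diff\<close>)
  qed
  have "card H = (\<Sum>d\<in>UNIV. card (?fib d))"
  proof -
    have "card H = card (\<Union>d\<in>UNIV. ?fib d)" by (rule arg_cong[where f = card]) auto
    also have "\<dots> = (\<Sum>d\<in>UNIV. card (?fib d))" by (rule card_UN_disjoint) (auto simp: fin)
    finally show ?thesis .
  qed
  also have "\<dots> = (\<Sum>d\<in>(UNIV :: 'a set). card (?fib c))"
    by (rule sum.cong[OF refl]) (rule trans[OF shift shift[symmetric]])
  finally have 1: "?q ^ n = ?q * card (?fib c)" by (simp add: H(2))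
  have "bij_betw (\<lambda>(x, c). x + c *s t) ({x \<in> T. x \<odot> y = c} \<times> UNIV) (?fib c)"
  proof (rule bij_betw_subset[OF T])
    have sur: "H = (\<lambda>(x, c). x + c *s t) ` (T \<times> UNIV)" using T by (simp add: bij_betw_def)
    show "(\<lambda>(x, c). x + c *s t) ` ({x \<in> T. x \<odot> y = c} \<times> UNIV) = ?fib c"
    proof (intro set_eqI iffI)
      fix v assume "v \<in> ?fib c"
      then obtain x d where x: "x \<in> T" "v = x + d *s t" "v \<odot> y = c" unfolding sur by auto
      then have "(x, d) \<in> {x \<in> T. x \<odot> y = c} \<times> UNIV" using y by (simp add: scalar_product_simps)
      with x(2) show "v \<in> (\<lambda>(x, c). x + c *s t) ` ({x \<in> T. x \<odot> y = c} \<times> UNIV)" by force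
    next
      fix v assume "v \<in> (\<lambda>(x, c). x + c *s t) ` ({x \<in> T. x \<odot> y = c} \<times> UNIV)"
      then obtain x d where x: "x \<in> T" "x \<odot> y = c" "v = x + d *s t" by auto
      then have "v \<in> H" unfolding sur by force
      with x y show "v \<in> ?fib c" by (simp add: scalar_product_simps)
    qed
  qed auto
  then have "card (?fib c) = card ({x \<in> T. x \<odot> y = c} \<times> (UNIV :: 'a set))"
    by (rule bij_betw_same_card[symmetric])
  with 1 have "?q ^ n = ?q * (?q * card {x \<in> T. x \<odot> y = c})"
    by (simp add: card_cartesian_product mult.commute)
  moreover have "?q ^ n = ?q * (?q * ?q ^ (n - 2))"
    using n by (metis power_add power2_eq_square le_add_diff_inverse mult.assoc)
  ultimately show ?thesis by simp
qed

text \<open>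
  A functional vanishing on \<open>t\<close> takes every value equally often on the transversal, so the product
  is the power of \<open>\<Prod>c. 1 + c X\<close> with exponent \<open>r = q ^ (n - 2)\<close>. Both coefficients vanish because
  \<open>r = 0\<close> in the field and \<open>\<Sum>c. c = 0\<close> for \<open>q > 2\<close>; for \<open>q = 2\<close> one needs that 4 divides \<open>r\<close>.
\<close>

lemma coeff_prod_transversal:
  fixes t y :: "'a::{field,finite} ^ 'm::finite"
  assumes H: "vec.subspace H" "card H = CARD('a) ^ n" and n: "n \<ge> 3"
    and not_2_3: "\<not> (CARD('a) = 2 \<and> n = 3)"
    and T: "bij_betw (\<lambda>(x, c). x + c *s t) (T \<times> UNIV) H"
    and y: "t \<odot> y = 0"
  shows "coeff (\<Prod>x\<in>T. [:1, x \<odot> y:]) (Suc 0) = 0" "coeff (\<Prod>x\<in>T. [:1, x \<odot> y:]) 2 = 0"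
proof -
  let ?q = "CARD('a)"
  let ?p = "\<Prod>x\<in>T. [:1, x \<odot> y:]"
  have TH: "T \<subseteq> H"
  proof
    fix x assume "x \<in> T"
    then have "(\<lambda>(x, c). x + c *s t) (x, 0) \<in> H" using bij_betwE[OF T] by blast
    then show "x \<in> H" by simp
  qed
  have "coeff ?p (Suc 0) = 0 \<and> coeff ?p 2 = 0"
  proof (cases "\<exists>z\<in>H. z \<odot> y \<noteq> 0")
    case False
    then have "?p = (\<Prod>x\<in>T. 1)" using TH by (intro prod.cong) (auto simp: one_pCons)
    then show ?thesis by (simp add: numeral_2_eq_2)
  next
    case True
    then obtain z where z: "z \<in> H" "z \<odot> y \<noteq> 0" by blast
    define r where "r = ?q ^ (n - 2)"
    define g :: "'a poly" where "g = (\<Prod>c\<in>UNIV. [:1, c:])"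
    have fib: "card {x \<in> T. x \<odot> y = c} = r" for c
      unfolding r_def using n by (intro card_fibre_transversal[OF H _ T y z]) simp
    have "?p = (\<Prod>c\<in>UNIV. \<Prod>x\<in>{x \<in> T. x \<odot> y = c}. [:1, x \<odot> y:])"
      by (rule prod.group[symmetric]) auto
    also have "\<dots> = (\<Prod>c\<in>UNIV. [:1, c:] ^ r)"
    proof (rule prod.cong[OF refl])
      fix c
      have "(\<Prod>x\<in>{x \<in> T. x \<odot> y = c}. [:1, x \<odot> y:]) = (\<Prod>x\<in>{x \<in> T. x \<odot> y = c}. [:1, c:])"
        by (rule prod.cong) auto
      then show "(\<Prod>x\<in>{x \<in> T. x \<odot> y = c}. [:1, x \<odot> y:]) = [:1, c:] ^ r" by (simp add: fib)
    qed
    finally have p: "?p = g ^ r" by (simp add: g_def prod_power_distrib)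
    have g: "coeff g 0 = 1" "coeff g (Suc 0) = (\<Sum>c\<in>UNIV. c)"
      unfolding g_def by (rule coeff_prod_linear_factors_0, rule coeff_prod_linear_factors_1)
    have r0: "of_nat r = (0 :: 'a)"
      using n by (simp add: r_def of_nat_CARD_eq_0)
    have "of_nat (r choose 2) * (coeff g (Suc 0))\<^sup>2 = 0"
    proof (cases "?q = 2")
      case True
      with not_2_3 n have "n \<ge> 4" by auto
      then obtain k where k: "n = 4 + k" using le_Suc_ex by blast
      have "r = 4 * 2 ^ k" by (simp add: r_def True k power_add)
      \<comment> \<open>The binomial coefficient is r (r - 1) / 2; a factor 2 survives the halving
        because 4 divides \<open>r\<close>.\<close>
      then have "r choose 2 = 2 * (2 ^ k * (r - 1))"
        by (simp add: choose_two)
      moreover have "(2 :: 'a) = 0" using of_nat_CARD_eq_0[where 'a = 'a] True by simp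
      ultimately show ?thesis by simp
    next
      case False
      moreover have "card {0, 1 :: 'a} \<le> ?q" by (rule card_mono) auto
      ultimately show ?thesis using sum_UNIV_field_eq_0[where 'a = 'a] g by simp
    qed
    then show ?thesis
      by (simp add: p coeff_power_1[OF g(1)] coeff_power_2[OF g(1)] r0)
  qed
  then show "coeff ?p (Suc 0) = 0" "coeff ?p 2 = 0" by auto
qed

text \<open>Two applications of \<open>inj_mod_extend\<close> complete \<open>X\<close> to a full
  transversal of \<open>H\<close> modulo \<open>t\<close>. Its product is that of \<open>X\<close>
  times the factors of \<open>a\<close> and \<open>b\<close>, so the vanishing of the two
  coefficients expresses a + b and a b through \<open>X\<close> alone.\<close>

lemma missing_classes:
  fixes X :: "('a::{field,finite} ^ 'm::finite) set"
  assumes H: "vec.subspace H" "card H = CARD('a) ^ n" and n: "n \<ge> 3"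
    and not_2_3: "\<not> (CARD('a) = 2 \<and> n = 3)"
    and X: "X \<subseteq> H" "card X + 2 = CARD('a) ^ (n - 1)"
  shows "\<exists>s Q. s \<in> H \<and> quadratic_form_on UNIV Q \<and>
    (\<forall>t\<in>H. t \<noteq> 0 \<longrightarrow> inj_mod t X \<longrightarrow>
      (\<exists>a\<in>H. \<exists>b\<in>H. a \<noteq> b \<and> a \<notin> X \<and> b \<notin> X \<and> inj_mod t (insert a (insert b X)) \<and>
        (\<forall>y. t \<odot> y = 0 \<longrightarrow> a \<odot> y + b \<odot> y = s \<odot> y \<and> (a \<odot> y) * (b \<odot> y) = Q y)))"
proof -
  let ?q = "CARD('a)"
  define e2 where "e2 y = coeff (\<Prod>x\<in>X. [:1, x \<odot> y:]) 2" for y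
  \<comment> \<open>With e1, e2 the symmetric functions of \<open>X\<close>, the vanishing
    conditions are e1 + a + b = 0 and e2 + e1 (a + b) + a b = 0. They give a + b = -e1 = s and a b =
    s^2 - e2.\<close>
  define s where "s = - (\<Sum>x\<in>X. x)"
  define Q where "Q y = (s \<odot> y) * (s \<odot> y) - e2 y" for y
  have "s \<in> H"
    unfolding s_def using H(1) X(1) by (auto intro!: vec.subspace_neg vec.subspace_sum)
  moreover have "quadratic_form_on UNIV Q"
    unfolding Q_def e2_def
    by (intro quadratic_form_on_diff quadratic_form_on_mult quadratic_form_coeff_2)
  moreover have "\<exists>a\<in>H. \<exists>b\<in>H. a \<noteq> b \<and> a \<notin> X \<and> b \<notin> X \<and> inj_mod t (insert a (insert b X)) \<and>
        (\<forall>y. t \<odot> y = 0 \<longrightarrow> a \<odot> y + b \<odot> y = s \<odot> y \<and> (a \<odot> y) * (b \<odot> y) = Q y)"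
    if t: "t \<in> H" "t \<noteq> 0" and inj: "inj_mod t X" for t
  proof -
    have q0: "?q > 0" by simp
    have cH: "card H = ?q ^ (n - 1) * ?q"
      using n power_minus_mult[of n ?q] by (simp add: H(2))
    have fin: "finite (Y :: ('a ^ 'm) set)" for Y by simp
    have "card X < ?q ^ (n - 1)" using X(2) by linarith
    then have "card X * ?q < card H" using q0 by (simp add: cH)
    then obtain b where b: "b \<in> H" "b \<notin> X" "inj_mod t (insert b X)"
      using inj_mod_extend[OF H(1) t X(1) inj] by auto
    then have "card (insert b X) < ?q ^ (n - 1)" using X(2) fin by simp
    then have "card (insert b X) * ?q < card H" using q0 by (simp add: cH)
    then obtain a where a: "a \<in> H" "a \<notin> insert b X" "inj_mod t (insert a (insert b X))"
      using inj_mod_extend[OF H(1) t _ b(3)] b(1) X(1) by auto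
    let ?T = "insert a (insert b X)"
    let ?F = "\<lambda>(x, c). x + c *s t"
    have "card ?T = ?q ^ (n - 1)" using a b X(2) fin by simp
    moreover have inj: "inj_on ?F (?T \<times> UNIV)" using inj_on_inj_mod[OF t(2)] a(3) by blast
    ultimately have "card (?F ` (?T \<times> UNIV)) = card H"
      by (simp only: card_image card_cartesian_product cH)
    moreover have "?F ` (?T \<times> UNIV) \<subseteq> H"
      using a b X(1) t H(1) by (auto intro!: vec.subspace_add vec.subspace_scale)
    ultimately have "?F ` (?T \<times> UNIV) = H" using card_subset_eq[OF fin] by blast
    with inj have bij: "bij_betw ?F (?T \<times> UNIV) H" by (simp add: bij_betw_def)
    have "a \<odot> y + b \<odot> y = s \<odot> y \<and> (a \<odot> y) * (b \<odot> y) = Q y" if y: "t \<odot> y = 0" for y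
    proof -
      let ?p = "\<Prod>x\<in>X. [:1, x \<odot> y:]"
      have T: "(\<Prod>x\<in>?T. [:1, x \<odot> y:]) = [:1, a \<odot> y:] * ([:1, b \<odot> y:] * ?p)"
        using a(2) b(2) fin by simp
      have p: "coeff ?p 0 = 1" "coeff ?p (Suc 0) = - (s \<odot> y)"
        unfolding coeff_prod_linear_factors_0 coeff_prod_linear_factors_1
          scalar_product_sum_left[symmetric] s_def
        by (simp_all add: scalar_product_minus_left)
      note c = coeff_prod_transversal[OF H n not_2_3 bij y, unfolded T numeral_2_eq_2
          coeff_linear_factor_mult p]
      have 1: "s \<odot> y = a \<odot> y + b \<odot> y" using c(1) by (simp add: algebra_simps)
      have "e2 y + (a \<odot> y + b \<odot> y) * - (s \<odot> y) + (a \<odot> y) * (b \<odot> y) = 0"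
        using c(2) by (simp add: e2_def numeral_2_eq_2 algebra_simps)
      then show ?thesis unfolding Q_def 1[symmetric] by (simp add: algebra_simps)
    qed
    with a b show ?thesis by blast
  qed
  ultimately show ?thesis by blast
qed

subsection \<open>The position of the non-determined directions\<close>

lemma span_singleton_scale:
  assumes "c \<noteq> 0" shows "vec.span {c *s v} = vec.span {v :: 'a::field ^ 'm::finite}"
proof -
  have "v = inverse c *s (c *s v)" using assms by simp
  then have "v \<in> vec.span {c *s v}" unfolding vec.span_singleton by blast
  moreover have "c *s v \<in> vec.span {v}" unfolding vec.span_singleton by blast
  ultimately show ?thesis by (simp add: vec.span_eq)
qed

text \<open>Modulo \<open>t\<close>, the linear form \<open>t0\<close> divides a (s - a), hence one
  of the two factors; cancelling it leaves a linear relation. The second conclusion retains that the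
  two missing classes are distinct, as s - 2 l t0 is congruent to s - 2 a modulo
  \<open>t\<close>.\<close>

lemma direction_relation:
  fixes t0 t s w a :: "'a::field ^ 'm::finite"
  assumes t: "t0 \<notin> vec.span {t}"
    and eq: "\<And>y. t \<odot> y = 0 \<Longrightarrow> (t0 \<odot> y) * (w \<odot> y) = (a \<odot> y) * ((s - a) \<odot> y)"
    and a: "2 *s a - s \<notin> vec.span {t}"
  shows "\<exists>l k. w - l *s s + l\<^sup>2 *s t0 = k *s t \<and> s - (2 * l) *s t0 \<notin> vec.span {t}"
proof -
  \<comment> \<open>Exchanging \<open>a\<close> with \<open>s - a\<close> preserves the equation and
    only changes the sign of \<open>2 *s a - s\<close>, so \<open>a\<close> may be taken as the
    factor divisible by \<open>t0\<close>.\<close>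
  have "\<exists>a. a \<in> vec.span {t, t0} \<and> 2 *s a - s \<notin> vec.span {t} \<and>
      (\<forall>y. t \<odot> y = 0 \<longrightarrow> (t0 \<odot> y) * (w \<odot> y) = (a \<odot> y) * ((s - a) \<odot> y))"
  proof -
    have ab: "a \<in> vec.span {t, t0} \<or> s - a \<in> vec.span {t, t0}"
      by (rule mem_span_of_product_zero) (use eq in \<open>auto simp flip: eq\<close>)
    have "2 *s (s - a) - s = - (2 *s a - s)" by (vector algebra_simps)
    then have sa: "2 *s (s - a) - s \<notin> vec.span {t}" using a by (metis vec.span_neg minus_minus)
    from ab show ?thesis
    proof
      assume "a \<in> vec.span {t, t0}"
      with eq a show ?thesis by blast
    next
      assume "s - a \<in> vec.span {t, t0}"
      moreover have "\<forall>y. t \<odot> y = 0 \<longrightarrow>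
          (t0 \<odot> y) * (w \<odot> y) = ((s - a) \<odot> y) * ((s - (s - a)) \<odot> y)"
        using eq by (simp add: mult.commute)
      ultimately show ?thesis using sa by blast
    qed
  qed
  then obtain a where a: "a \<in> vec.span {t, t0}" "2 *s a - s \<notin> vec.span {t}"
    and eq: "\<And>y. t \<odot> y = 0 \<Longrightarrow> (t0 \<odot> y) * (w \<odot> y) = (a \<odot> y) * ((s - a) \<odot> y)"
    by blast
  obtain k l where "a - k *s t = l *s t0"
    using a(1) unfolding vec.span_insert[of t] vec.span_singleton by blast
  then have al: "a = l *s t0 + k *s t" by (simp add: algebra_simps)
  have "t0 \<in> vec.span {t} \<or> w - l *s s + l\<^sup>2 *s t0 \<in> vec.span {t}"
  proof (rule mem_span_of_product_zero)
    fix y assume "\<And>v. v \<in> {t} \<Longrightarrow> v \<odot> y = 0"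
    then have y: "t \<odot> y = 0" by simp
    from eq[OF y] y show "(t0 \<odot> y) * ((w - l *s s + l\<^sup>2 *s t0) \<odot> y) = 0"
      by (simp add: al scalar_product_simps algebra_simps power2_eq_square)
  qed
  then obtain k' where "w - l *s s + l\<^sup>2 *s t0 = k' *s t"
    using t unfolding vec.span_singleton by blast
  moreover have "s - (2 * l) *s t0 \<notin> vec.span {t}"
  proof
    assume "s - (2 * l) *s t0 \<in> vec.span {t}"
    moreover have "(2 * k) *s t \<in> vec.span {t}" by (intro vec.span_scale vec.span_base) simp
    ultimately have "(2 * k) *s t - (s - (2 * l) *s t0) \<in> vec.span {t}"
      using vec.span_diff by blast
    moreover have "(2 * k) *s t - (s - (2 * l) *s t0) = 2 *s a - s"
      unfolding al by (vector algebra_simps)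
    ultimately show False using a(2) by simp
  qed
  ultimately show ?thesis by blast
qed

text \<open>If \<open>w\<close> is independent of \<open>s\<close> and \<open>t0\<close>, then
  \<open>k\<close> is never 0 and the relation parametrises a conic. Otherwise w = \<alpha> s +
  \<beta> t0 and the relation becomes (\<alpha> - l) s + (l^2 + \<beta>) t0 = k t, whose left side
  vanishes for some \<open>l\<close> iff \<alpha>^2 + \<beta> = 0.\<close>

lemma direction_trichotomy:
  fixes s t0 w :: "'a::{field,finite} ^ 'm::finite"
  assumes s: "s \<notin> vec.span {t0}" and t0: "t0 \<noteq> 0"
    and rel: "\<And>t. t \<in> G \<Longrightarrow> t0 \<notin> vec.span {t} \<Longrightarrow>
      \<exists>l k. w - l *s s + l\<^sup>2 *s t0 = k *s t \<and> s - (2 * l) *s t0 \<notin> vec.span {t}"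
  obtains (split) l where "w - l *s s + l\<^sup>2 *s t0 = 0"
    | (line) M where "2 * card M + 1 \<le> CARD('a)"
      "\<And>t. t \<in> G \<Longrightarrow>
        vec.span {t} = vec.span {t0} \<or> (\<exists>m\<in>M. vec.span {t} = vec.span {s - m *s t0})"
    | (conic) "w \<notin> vec.span {s, t0}"
      "\<And>t. t \<in> G \<Longrightarrow> \<exists>a b c. t = a *s s + b *s t0 + c *s w \<and> a\<^sup>2 = b * c"
proof -
  have at_t0: "\<exists>c. t = c *s t0 \<and> vec.span {t} = vec.span {t0}" if mem: "t0 \<in> vec.span {t}" for t
  proof -
    obtain c where c: "t0 = c *s t" using mem unfolding vec.span_singleton by blast
    with t0 have "c \<noteq> 0" by auto
    then have "t = inverse c *s t0" "vec.span {t} = vec.span {t0}"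
      using span_singleton_scale[of c t] c by auto
    then show ?thesis by blast
  qed
  show thesis
  proof (cases "w \<in> vec.span {s, t0}")
    case False
    have "\<exists>a b c. t = a *s s + b *s t0 + c *s w \<and> a\<^sup>2 = b * c" if t: "t \<in> G" for t
    proof (cases "t0 \<in> vec.span {t}")
      case True
      then obtain c where "t = c *s t0" using at_t0 by blast
      then have "t = 0 *s s + c *s t0 + 0 *s w \<and> 0\<^sup>2 = c * 0" by simp
      then show ?thesis by blast
    next
      case False
      with rel t obtain l k where lk: "w - l *s s + l\<^sup>2 *s t0 = k *s t" by blast
      have "k \<noteq> 0"
      proof
        assume "k = 0"
        then have "w = l *s s - l\<^sup>2 *s t0" using lk by (simp add: algebra_simps eq_neg_iff_add_eq_0)
        also have "\<dots> \<in> vec.span {s, t0}"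
          by (intro vec.span_diff vec.span_scale vec.span_base) auto
        finally show False using \<open>w \<notin> vec.span {s, t0}\<close> by simp
      qed
      then have "t = inverse k *s (w - l *s s + l\<^sup>2 *s t0)" unfolding lk by simp
      also have "\<dots> = (- l / k) *s s + (l\<^sup>2 / k) *s t0 + (1 / k) *s w"
        by (vector algebra_simps divide_inverse)
      finally have "t = (- l / k) *s s + (l\<^sup>2 / k) *s t0 + (1 / k) *s w" .
      moreover have "(- l / k)\<^sup>2 = (l\<^sup>2 / k) * (1 / k)" by (simp add: power2_eq_square)
      ultimately show ?thesis by blast
    qed
    with False show thesis by (rule conic)
  next
    case True
    then obtain \<alpha> \<beta> where "w - \<alpha> *s s = \<beta> *s t0"
      unfolding vec.span_insert[of s] vec.span_singleton by blast
    then have w: "w = \<alpha> *s s + \<beta> *s t0" by (simp add: algebra_simps)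
    have w': "w - l *s s + l\<^sup>2 *s t0 = (\<alpha> - l) *s s + (l\<^sup>2 + \<beta>) *s t0" for l
      unfolding w by (vector algebra_simps)
    show thesis
    proof (cases "\<alpha>\<^sup>2 + \<beta> = 0")
      case True
      with w'[of \<alpha>] show thesis by (intro split[of \<alpha>]) simp
    next
      case False
      \<comment> \<open>Dividing (\<alpha> - l) s + (l^2 + \<beta>) t0 by \<alpha> - l gives s -
        g(l) t0. The value l = \<alpha> would put \<open>t0\<close> in the span of \<open>t\<close>,
        so it is excluded.\<close>
      define g where "g l = (l\<^sup>2 + \<beta>) / (l - \<alpha>)" for l
      define M where "M = {m. \<exists>l l'. l \<noteq> l' \<and> l \<noteq> \<alpha> \<and> l' \<noteq> \<alpha> \<and> g l = m \<and> g l' = m}"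
      show thesis
      proof (rule line[of M])
        \<comment> \<open>With \<open>l\<close>, also \<open>m - l\<close> is a solution of \<open>g l = m\<close>, and the missing classes being
          distinct means \<open>m \<noteq> 2 l\<close>: so \<open>g\<close> is at least two-to-one onto the relevant \<open>m\<close>.\<close>
        let ?fib = "\<lambda>m. {l. l \<noteq> \<alpha> \<and> g l = m}"
        have "2 \<le> card (?fib m)" if m: "m \<in> M" for m
        proof -
          obtain l l' where l: "l \<noteq> l'" "{l, l'} \<subseteq> ?fib m" using m unfolding M_def by blast
          have "card {l, l'} \<le> card (?fib m)" by (rule card_mono) (use l(2) in simp_all)
          with l(1) show ?thesis by simp
        qed
        then have "(\<Sum>m\<in>M. 2) \<le> (\<Sum>m\<in>M. card (?fib m))" by (rule sum_mono)
        also have "\<dots> = card (\<Union>m\<in>M. ?fib m)" by (rule card_UN_disjoint[symmetric]) auto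
        also have "\<dots> \<le> card (UNIV - {\<alpha>})" by (rule card_mono) auto
        finally have "2 * card M \<le> CARD('a) - 1" by (simp add: card_Diff_subset)
        moreover have "CARD('a) > 0" by simp
        ultimately show "2 * card M + 1 \<le> CARD('a)" by linarith
      next
        fix t assume t: "t \<in> G"
        show "vec.span {t} = vec.span {t0} \<or> (\<exists>m\<in>M. vec.span {t} = vec.span {s - m *s t0})"
        proof (cases "t0 \<in> vec.span {t}")
          case True
          with at_t0 show ?thesis by blast
        next
          case nt: False
          obtain l k where lk: "(\<alpha> - l) *s s + (l\<^sup>2 + \<beta>) *s t0 = k *s t"
            and l2: "s - (2 * l) *s t0 \<notin> vec.span {t}"
            using rel[OF t nt] unfolding w' by blast
          have l: "l \<noteq> \<alpha>"
          proof
            assume "l = \<alpha>"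
            then have "(\<alpha>\<^sup>2 + \<beta>) *s t0 \<in> vec.span {t}"
              using lk unfolding vec.span_singleton by auto
            then have "inverse (\<alpha>\<^sup>2 + \<beta>) *s ((\<alpha>\<^sup>2 + \<beta>) *s t0) \<in> vec.span {t}"
              by (rule vec.span_scale)
            with nt show False
              by (simp only: vector_smult_assoc left_inverse[OF False] vector_smult_lid)
          qed
          define m where "m = g l"
          have mg: "m * (l - \<alpha>) = l\<^sup>2 + \<beta>" using l by (simp add: m_def g_def)
          have "(\<alpha> - l) *s (s - m *s t0) = (\<alpha> - l) *s s + (m * (l - \<alpha>)) *s t0"
            by (vector algebra_simps)
          also have "\<dots> = k *s t" unfolding mg by (rule lk)
          finally have st: "(\<alpha> - l) *s (s - m *s t0) = k *s t" .
          have "s - m *s t0 \<noteq> 0"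
          proof
            assume "s - m *s t0 = 0"
            then show False using s unfolding vec.span_singleton by auto
          qed
          moreover have "(\<alpha> - l) *s (s - m *s t0) = 0" if "k = 0" unfolding st that by simp
          ultimately have "k \<noteq> 0" using l by (auto simp only: vec.scale_eq_0_iff right_minus_eq)
          then have sp: "vec.span {t} = vec.span {s - m *s t0}"
            using st l by (metis span_singleton_scale right_minus_eq)
          have "m \<noteq> 2 * l" using l2 sp vec.span_base[of "s - m *s t0" "{s - m *s t0}"] by auto
          then have "l \<noteq> m - l" by (auto simp: eq_diff_eq)
          \<comment> \<open>\<open>l\<close> and \<open>m - l\<close> are the two roots of x^2 +
            \<beta> - m (x - \<alpha>). At x = \<alpha> this polynomial takes the value \<alpha>^2 +
            \<beta>, which is nonzero here.\<close>
          moreover have "m - l \<noteq> \<alpha>"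
          proof
            assume "m - l = \<alpha>"
            then have "m = \<alpha> + l" by (simp add: algebra_simps)
            then have "\<alpha>\<^sup>2 + \<beta> = 0" using mg by (simp add: algebra_simps power2_eq_square)
            with False show False by simp
          qed
          moreover have "g (m - l) = m"
          proof -
            have "(m - l)\<^sup>2 + \<beta> = m * (m - l - \<alpha>) + (l\<^sup>2 + \<beta> - m * (l - \<alpha>))"
              by (simp add: algebra_simps power2_eq_square)
            then have "(m - l)\<^sup>2 + \<beta> = m * (m - l - \<alpha>)" by (simp add: mg)
            with \<open>m - l \<noteq> \<alpha>\<close> show ?thesis by (simp add: g_def)
          qed
          ultimately have "m \<in> M"
            unfolding M_def using l m_def[symmetric] by blast
          with sp show ?thesis by blast
        qed
      qed
    qed
  qed
qed

lemma inj_mod_insert: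
  assumes "a \<notin> T"
  shows "inj_mod t (insert a T) \<longleftrightarrow> inj_mod t T \<and> (\<forall>x\<in>T. a - x \<notin> vec.span {t})"
proof -
  have "x - a \<in> vec.span {t} \<longleftrightarrow> a - x \<in> vec.span {t}" for x
    by (metis minus_diff_eq vec.span_neg)
  with assms show ?thesis unfolding inj_mod_def by (auto; metis)
qed

text \<open>Only the class of \<open>a\<close> modulo \<open>t\<close> matters. This allows
  representatives of the missing classes that depend on \<open>t\<close> to be replaced by ones
  common to all \<open>t\<close>.\<close>

lemma inj_mod_exchange:
  assumes T: "inj_mod t (insert a T)" "a \<notin> T" and a': "a' - a \<in> vec.span {t}"
  shows "inj_mod t (insert a' T)" "a' \<notin> T"
proof -
  have no: "a' - x \<notin> vec.span {t}" if "x \<in> T" for x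
  proof
    assume "a' - x \<in> vec.span {t}"
    then have "(a' - x) - (a' - a) \<in> vec.span {t}" using a' vec.span_diff by blast
    then show False using T that by (simp add: inj_mod_insert)
  qed
  show "a' \<notin> T" using no[of a'] vec.span_zero by auto
  then show "inj_mod t (insert a' T)" using T no by (simp add: inj_mod_insert)
qed

lemma mem_span_singletonI:
  fixes p :: "'a::field ^ 'm::finite"
  assumes "\<And>y. t \<odot> y = 0 \<Longrightarrow> p \<odot> y = 0"
  shows "p \<in> vec.span {t}"
  using mem_span_of_product_zero[of "{t}" p p] assms by simp

lemma undetermined_trichotomy:
  fixes X :: "('a::{field,finite} ^ 'm::finite) set"
  assumes H: "vec.subspace H" "card H = CARD('a) ^ n" and n: "n \<ge> 3"
    and not_2_3: "\<not> (CARD('a) = 2 \<and> n = 3)"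
    and X: "X \<subseteq> H" "card X + 2 = CARD('a) ^ (n - 1)"
    and t0: "t0 \<in> H" "t0 \<noteq> 0" "inj_mod t0 X"
  obtains (extend) X' where "X \<subseteq> X'" "X' \<subseteq> H" "card X' = CARD('a) ^ (n - 1)"
      "\<And>t. t \<in> H \<Longrightarrow> t \<noteq> 0 \<Longrightarrow> inj_mod t X \<Longrightarrow> inj_mod t X'"
    | (line) s M where "s \<notin> vec.span {t0}" "2 * card M + 1 \<le> CARD('a)"
      "\<And>t. t \<in> H \<Longrightarrow> t \<noteq> 0 \<Longrightarrow> inj_mod t X \<Longrightarrow>
        vec.span {t} = vec.span {t0} \<or> (\<exists>m\<in>M. vec.span {t} = vec.span {s - m *s t0})"
    | (conic) s w where "s \<notin> vec.span {t0}" "w \<notin> vec.span {s, t0}"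
      "\<And>t. t \<in> H \<Longrightarrow> t \<noteq> 0 \<Longrightarrow> inj_mod t X \<Longrightarrow>
        \<exists>a b c. t = a *s s + b *s t0 + c *s w \<and> a\<^sup>2 = b * c"
proof -
  have fin: "finite (Y :: ('a ^ 'm) set)" for Y by simp
  define G where "G = {t \<in> H. t \<noteq> 0 \<and> inj_mod t X}"
  obtain s0 Q where s0: "s0 \<in> H" and Q: "quadratic_form_on UNIV Q" and
    missing: "\<And>t. t \<in> G \<Longrightarrow>
      \<exists>a\<in>H. \<exists>b\<in>H. a \<noteq> b \<and> a \<notin> X \<and> b \<notin> X \<and> inj_mod t (insert a (insert b X)) \<and>
        (\<forall>y. t \<odot> y = 0 \<longrightarrow> a \<odot> y + b \<odot> y = s0 \<odot> y \<and> (a \<odot> y) * (b \<odot> y) = Q y)"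
    using missing_classes[OF H n not_2_3 X] unfolding G_def by blast
  have missing': "\<exists>a. a \<in> H \<and> 2 *s a - s0 \<notin> vec.span {t} \<and>
      (\<forall>y. t \<odot> y = 0 \<longrightarrow> Q y = (a \<odot> y) * ((s0 - a) \<odot> y))" if t: "t \<in> G" for t
  proof -
    obtain a b where ab: "a \<in> H" "a \<noteq> b" "inj_mod t (insert a (insert b X))"
      and eq: "\<And>y. t \<odot> y = 0 \<Longrightarrow> s0 \<odot> y = a \<odot> y + b \<odot> y"
        "\<And>y. t \<odot> y = 0 \<Longrightarrow> Q y = (a \<odot> y) * (b \<odot> y)"
      using missing[OF t] by metis
    \<comment> \<open>On the annihilator of \<open>t\<close> the vector \<open>s0\<close> agrees
      with a + b, so \<open>2 *s a - s0\<close> is congruent to a - b modulo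
      \<open>t\<close>.\<close>
    have "(2 *s a - s0) - (a - b) \<in> vec.span {t}"
      by (rule mem_span_singletonI) (simp add: scalar_product_simps eq)
    moreover have "a - b \<notin> vec.span {t}" using ab unfolding inj_mod_def by simp
    ultimately have "2 *s a - s0 \<notin> vec.span {t}"
      using vec.span_diff[of "2 *s a - s0" "{t}" "(2 *s a - s0) - (a - b)"] by auto
    with ab(1) show ?thesis by (auto simp: eq scalar_product_simps)
  qed
  have "t0 \<in> G" using t0 by (simp add: G_def)
  from missing'[OF this] obtain a0 where a0: "a0 \<in> H" "2 *s a0 - s0 \<notin> vec.span {t0}"
    and Q0: "\<And>y. t0 \<odot> y = 0 \<Longrightarrow> Q y = (a0 \<odot> y) * ((s0 - a0) \<odot> y)" by blast
  \<comment> \<open>Translating the origin to \<open>a0\<close> turns the missing pair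
    \<open>a\<close>, \<open>s0 - a\<close> into \<open>a - a0\<close>, \<open>s - (a - a0)\<close>
    with the \<open>s\<close> defined below, and the product form into the difference on the
    left.\<close>
  have "\<exists>w. \<forall>y. Q y - (a0 \<odot> y) * ((s0 - a0) \<odot> y) = (t0 \<odot> y) * (w \<odot> y)"
    by (rule quadratic_form_zero_on_hyperplane)
      (use Q0 t0(2) in \<open>auto intro: quadratic_form_on_diff quadratic_form_on_mult Q\<close>)
  then obtain w where w: "\<And>y. Q y - (a0 \<odot> y) * ((s0 - a0) \<odot> y) = (t0 \<odot> y) * (w \<odot> y)"
    by blast
  define s where "s = s0 - 2 *s a0"
  have s: "s \<notin> vec.span {t0}"
    using a0(2) vec.span_neg[of s "{t0}"] by (auto simp: s_def)
  have rel: "\<exists>l k. w - l *s s + l\<^sup>2 *s t0 = k *s t \<and> s - (2 * l) *s t0 \<notin> vec.span {t}"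
    if t: "t \<in> G" "t0 \<notin> vec.span {t}" for t
  proof -
    obtain a where a: "2 *s a - s0 \<notin> vec.span {t}"
      and eq: "\<And>y. t \<odot> y = 0 \<Longrightarrow> Q y = (a \<odot> y) * ((s0 - a) \<odot> y)"
      using missing'[OF t(1)] by blast
    show ?thesis
    proof (rule direction_relation[OF t(2), of w "a - a0"])
      have "2 *s (a - a0) - s = 2 *s a - s0" unfolding s_def by (vector algebra_simps)
      then show "2 *s (a - a0) - s \<notin> vec.span {t}" using a by (simp only: not_False_eq_True)
      show "(t0 \<odot> y) * (w \<odot> y) = ((a - a0) \<odot> y) * ((s - (a - a0)) \<odot> y)" if "t \<odot> y = 0" for y
        unfolding w[symmetric] eq[OF that]
        by (simp add: s_def scalar_product_simps algebra_simps)
    qed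
  qed
  show thesis
  proof (rule direction_trichotomy[OF s t0(2) rel])
    fix l assume l: "w - l *s s + l\<^sup>2 *s t0 = 0"
    \<comment> \<open>Here w = l (s - l t0), so the translated form factors as (l t0) (s - l t0);
      \<open>a\<close> and \<open>b\<close> are these two factors translated back by
      \<open>a0\<close>.\<close>
    define a where "a = a0 + l *s t0"
    define b where "b = s0 - a"
    have ab: "a \<in> H" "b \<in> H"
      unfolding a_def b_def using H(1) a0(1) s0 t0(1)
      by (auto intro!: vec.subspace_add vec.subspace_diff vec.subspace_scale)
    have wl: "w = l *s s - l\<^sup>2 *s t0"
      using l by (simp add: algebra_simps eq_neg_iff_add_eq_0)
    have Qab: "Q y = (a \<odot> y) * (b \<odot> y)" for y
    proof -
      have "Q y = (a0 \<odot> y) * ((s0 - a0) \<odot> y) + (t0 \<odot> y) * (w \<odot> y)"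
        using w[of y] by (simp add: algebra_simps)
      then show ?thesis
        by (simp add: a_def b_def wl s_def scalar_product_simps algebra_simps power2_eq_square)
    qed
    have ext: "inj_mod t (insert b (insert a X)) \<and> b \<notin> insert a X \<and> a \<notin> X" if t: "t \<in> G" for t
    proof -
      \<comment> \<open>If \<open>a\<close> is in the class of one missing representative, the
        common sum \<open>s0\<close> forces \<open>b\<close> into the class of the other, and two
        exchanges finish.\<close>
      have main: ?thesis if c: "inj_mod t (insert c (insert d X))" "c \<noteq> d" "c \<notin> X" "d \<notin> X"
        and eq: "\<And>y. t \<odot> y = 0 \<Longrightarrow> s0 \<odot> y = c \<odot> y + d \<odot> y"
        and ac: "a - c \<in> vec.span {t}" for c d
      proof -
        have "b - d + (a - c) \<in> vec.span {t}"
          by (rule mem_span_singletonI) (simp add: b_def scalar_product_simps eq)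
        then have "b - d \<in> vec.span {t}"
          using vec.span_diff[OF _ ac, of "b - d + (a - c)"] by simp
        moreover have 1: "inj_mod t (insert a (insert d X))" "a \<notin> insert d X"
          using inj_mod_exchange[OF c(1) _ ac] c(2,3) by auto
        then have "inj_mod t (insert d (insert a X))" "d \<notin> insert a X"
          using c(4) by (auto simp: insert_commute)
        ultimately show ?thesis using inj_mod_exchange 1(2) by blast
      qed
      obtain c d where c: "inj_mod t (insert c (insert d X))" "c \<noteq> d" "c \<notin> X" "d \<notin> X"
        and eq: "\<And>y. t \<odot> y = 0 \<Longrightarrow> s0 \<odot> y = c \<odot> y + d \<odot> y"
          "\<And>y. t \<odot> y = 0 \<Longrightarrow> Q y = (c \<odot> y) * (d \<odot> y)"
        using missing[OF t] by metis
      \<comment> \<open>On the annihilator of \<open>t\<close>, \<open>a\<close> is a root of x^2 -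
        s0 x + Q = (x - c) (x - d), because Q = a (s0 - a).\<close>
      have "a - c \<in> vec.span {t} \<or> a - d \<in> vec.span {t}"
      proof (rule mem_span_of_product_zero)
        fix y assume "\<And>v. v \<in> {t} \<Longrightarrow> v \<odot> y = 0"
        then have y: "t \<odot> y = 0" by simp
        have "((a - c) \<odot> y) * ((a - d) \<odot> y) =
            (a \<odot> y)\<^sup>2 - (a \<odot> y) * (c \<odot> y + d \<odot> y) + (c \<odot> y) * (d \<odot> y)"
          by (simp add: scalar_product_simps algebra_simps power2_eq_square)
        also have "\<dots> = 0"
          unfolding eq[OF y, symmetric] Qab b_def
          by (simp add: scalar_product_simps algebra_simps power2_eq_square)
        finally show "((a - c) \<odot> y) * ((a - d) \<odot> y) = 0" .
      qed
      then show ?thesis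
      proof
        assume "a - c \<in> vec.span {t}"
        with main c eq(1) show ?thesis by blast
      next
        assume ad: "a - d \<in> vec.span {t}"
        show ?thesis
          by (rule main[OF _ _ _ _ _ ad, of c])
            (use c eq(1) in \<open>auto simp: insert_commute add.commute\<close>)
      qed
    qed
    show thesis
    proof (rule extend)
      \<comment> \<open>The case \<open>t0\<close> of \<open>ext\<close> also supplies that
        \<open>a\<close> and \<open>b\<close> are distinct and outside \<open>X\<close>.\<close>
      show "card (insert b (insert a X)) = CARD('a) ^ (n - 1)"
        using ext[OF \<open>t0 \<in> G\<close>] X(2) fin by simp
    qed (use ab X(1) ext in \<open>auto simp: G_def\<close>)
  next
    fix M :: "'a set" assume "2 * card M + 1 \<le> CARD('a)"
      "\<And>t. t \<in> G \<Longrightarrow>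
        vec.span {t} = vec.span {t0} \<or> (\<exists>m\<in>M. vec.span {t} = vec.span {s - m *s t0})"
    then show thesis using line[OF s, of M] unfolding G_def by blast
  next
    assume "w \<notin> vec.span {s, t0}"
      "\<And>t. t \<in> G \<Longrightarrow> \<exists>a b c. t = a *s s + b *s t0 + c *s w \<and> a\<^sup>2 = b * c"
    then show thesis using conic[OF s, of w] unfolding G_def by blast
  qed
qed

section \<open>Coordinates for the conic\<close>

lemma span_tripleE:
  assumes "v \<in> vec.span {s, t, w :: 'a::field ^ 'm::finite}"
  obtains a b c where "v = a *s s + b *s t + c *s w"
proof -
  obtain a b c where "v - a *s s - b *s t = c *s w"
    using assms unfolding vec.span_insert[of s] vec.span_insert[of t] vec.span_singleton by blast
  then have "v = a *s s + b *s t + c *s w" by (simp add: algebra_simps)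
  then show thesis by (rule that)
qed

lemma planar_conic_coordinates:
  fixes s t w :: "'a::field ^ 'm::finite"
  assumes ind: "t \<noteq> 0" "s \<notin> vec.span {t}" "w \<notin> vec.span {s, t}"
  obtains C where "planar_conic C"
    "\<And>v a b c. v \<noteq> 0 \<Longrightarrow> v = a *s s + b *s t + c *s w \<Longrightarrow> a\<^sup>2 = b * c \<Longrightarrow> vec.span {v} \<in> C"
proof -
  have ne: "s \<noteq> t" "w \<noteq> s" "w \<noteq> t"
    using ind vec.span_base[of t "{t}"] vec.span_base[of s "{s, t}"] vec.span_base[of t "{s, t}"]
    by auto
  have "vec.independent {w, s, t}"
    using ind ne vec.independent_insert[of s "{t}"] vec.independent_insert[of w "{s, t}"] by simp
  moreover have "{w, s, t} - {s} = {t, w}" "{w, s, t} - {t} = {s, w}" using ne by auto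
  ultimately have ind': "s \<notin> vec.span {t, w}" "t \<notin> vec.span {s, w}"
    unfolding vec.dependent_def by auto
  \<comment> \<open>\<open>x\<close>, \<open>y\<close>, \<open>z\<close> are dual to
    \<open>s\<close>, \<open>t\<close>, \<open>w\<close>, so pairing with them reads off the
    coordinates a, b, c.\<close>
  obtain x where x: "t \<odot> x = 0" "w \<odot> x = 0" "s \<odot> x = 1"
    using separating_functional[OF ind'(1)] vec.span_base by (metis insertI1 insertI2)
  obtain y where y: "s \<odot> y = 0" "w \<odot> y = 0" "t \<odot> y = 1"
    using separating_functional[OF ind'(2)] vec.span_base by (metis insertI1 insertI2)
  obtain z where z: "s \<odot> z = 0" "t \<odot> z = 0" "w \<odot> z = 1"
    using separating_functional[OF ind(3)] vec.span_base by (metis insertI1 insertI2)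
  define W where "W = vec.span {s, t, w}"
  define Q where "Q v = (x \<odot> v) * (x \<odot> v) - (y \<odot> v) * (z \<odot> v)" for v
  have coord: "x \<odot> v = a" "y \<odot> v = b" "z \<odot> v = c" if "v = a *s s + b *s t + c *s w" for v a b c
    unfolding that scalar_product_commute[of x] scalar_product_commute[of y]
      scalar_product_commute[of z]
    by (simp_all add: scalar_product_simps x y z)
  have W: "W \<in> pg_planes"
  proof -
    have "{s, t, w} = {w, s, t}" by auto
    moreover have "vec.dim {w, s, t} = 3" using ind by (simp add: vec.dim_insert)
    ultimately show ?thesis unfolding pg_planes_def W_def by simp
  qed
  have "quadratic_form_on UNIV Q"
    unfolding Q_def by (intro quadratic_form_on_diff quadratic_form_on_mult)
  then have Q: "quadratic_form_on W Q" unfolding quadratic_form_on_def by blast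
  \<comment> \<open>Polarising a^2 - b c against \<open>t\<close> and \<open>w\<close> yields -c and
    -b. Once these vanish, \<open>Q v = 0\<close> reads a^2 = 0, which settles characteristic 2 as
    well.\<close>
  have "nonsingular_on W Q"
    unfolding nonsingular_on_def
  proof (intro ballI impI, elim conjE)
    fix v assume v: "v \<in> W" "Q v = 0" "\<forall>u\<in>W. polar_form Q v u = 0"
    obtain a b c where abc: "v = a *s s + b *s t + c *s w"
      using v(1) unfolding W_def by (rule span_tripleE)
    have polar: "polar_form Q v u = 2 * (x \<odot> v) * (x \<odot> u) - (y \<odot> v) * (z \<odot> u) - (z \<odot> v) * (y \<odot> u)"
      for u
      unfolding polar_form_def Q_def by (simp add: scalar_product_simps algebra_simps)
    have "t \<in> W" "w \<in> W" unfolding W_def by (auto intro: vec.span_base)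
    with v(3) have "polar_form Q v t = 0" "polar_form Q v w = 0" by auto
    moreover have "polar_form Q v t = - c"
      unfolding polar coord[OF abc] using coord[of t 0 1 0] by simp
    moreover have "polar_form Q v w = - b"
      unfolding polar coord[OF abc] using coord[of w 0 0 1] by simp
    moreover have "a * a - b * c = 0" using v(2) unfolding Q_def coord[OF abc] .
    ultimately show "v = 0" using abc by simp
  qed
  with W Q have "planar_conic {P \<in> pg_points. P \<subseteq> W \<and> (\<forall>v\<in>P. Q v = 0)}"
    unfolding planar_conic_def by blast
  moreover have "vec.span {v} \<in> {P \<in> pg_points. P \<subseteq> W \<and> (\<forall>v\<in>P. Q v = 0)}"
    if v: "v \<noteq> 0" "v = a *s s + b *s t + c *s w" "a\<^sup>2 = b * c" for v a b c
  proof -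
    have "v \<in> W"
      unfolding v(2) W_def by (intro vec.span_add vec.span_scale vec.span_base) auto
    then have "vec.span {v} \<subseteq> W" unfolding W_def by (simp add: vec.span_minimal)
    moreover have "vec.span {v} \<in> pg_points"
      unfolding pg_points_def using v(1) by (simp add: vec.dim_insert)
    moreover have "Q v = 0"
      unfolding Q_def coord[OF v(2)] using v(3) by (simp add: power2_eq_square)
    then have "Q u = 0" if "u \<in> vec.span {v}" for u
      using that Q \<open>v \<in> W\<close> unfolding quadratic_form_on_def vec.span_singleton by auto
    ultimately show ?thesis by blast
  qed
  ultimately show thesis by (rule that)
qed

subsection \<open>Translation to projective space\<close>

lemma pg_points_iff: "P \<in> pg_points \<longleftrightarrow> (\<exists>v. v \<noteq> 0 \<and> P = vec.span {v :: 'a::field ^ 'm::finite})"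
proof
  assume P: "P \<in> pg_points"
  then obtain B where B: "B \<subseteq> P" "vec.independent B" "P \<subseteq> vec.span B" "card B = 1"
    unfolding pg_points_def using vec.basis_exists[of P] by auto
  then obtain v where v: "B = {v}" by (auto simp: card_1_singleton_iff)
  have "P = vec.span {v}"
    using B P v vec.span_minimal[of B P] unfolding pg_points_def by auto
  moreover have "v \<noteq> 0" using B(2) v vec.dependent_zero by auto
  ultimately show "\<exists>v. v \<noteq> 0 \<and> P = vec.span {v}" by blast
qed (auto simp: pg_points_def vec.dim_insert)

lemma span_singleton_subset_iff:
  assumes "vec.subspace H" shows "vec.span {v} \<subseteq> H \<longleftrightarrow> v \<in> H"
  using assms vec.span_base[of v "{v}"] vec.span_minimal[of "{v}" H] by auto

lemma infinite_points_iff: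
  assumes "vec.subspace H"
  shows "P \<in> infinite_points H \<longleftrightarrow> (\<exists>v\<in>H. v \<noteq> 0 \<and> P = vec.span {v})"
  unfolding infinite_points_def pg_points_iff using span_singleton_subset_iff[OF assms] by auto

lemma pg_line_span:
  assumes "t \<noteq> 0" "s \<notin> vec.span {t}"
  shows "vec.span {s, t} \<in> pg_lines"
  using assms unfolding pg_lines_def by (simp add: vec.dim_insert)

lemma hyperplane_complement:
  fixes H :: "('a::field ^ 'm::finite) set"
  assumes H: "H \<in> pg_hyperplanes" and p: "p \<notin> H"
  shows "\<exists>x\<in>H. \<exists>c. v = x + c *s p"
proof -
  have sH: "vec.subspace H" and dH: "vec.dim H + 1 = CARD('m)"
    using H unfolding pg_hyperplanes_def by auto
  have sp: "vec.span H = H" using sH by simp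
  have "vec.dim (insert p H) = vec.dim H + 1"
    using p sp by (simp only: vec.dim_insert if_False)
  then have "vec.dim (UNIV :: ('a ^ 'm) set) \<le> vec.dim (insert p H)"
    using dH vec_dim_card[where 'a = 'a and 'n = 'm] by linarith
  then have "vec.span (insert p H) = UNIV"
    using vec.dim_eq_span[of "insert p H" UNIV] by simp
  then obtain c where "v - c *s p \<in> H"
    using vec.span_breakdown_eq[of v p H] sp by auto
  then show ?thesis by (intro bexI[of _ "v - c *s p"] exI[of _ c]) auto
qed

lemma scale_mem_subspace_iff:
  assumes "vec.subspace H" "p \<notin> H"
  shows "c *s p \<in> H \<longleftrightarrow> c = 0"
proof
  assume "c *s p \<in> H"
  then have "inverse c *s (c *s p) \<in> H" using assms(1) by (rule vec.subspace_scale[rotated])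
  then show "c = 0" using assms(2) by (cases "c = 0") (auto simp: vector_smult_assoc)
qed (simp add: assms vec.subspace_0)

text \<open>Every vector is uniquely a vector of \<open>H\<close> plus a multiple of
  \<open>p\<close>, so \<open>H\<close> has a share of 1/q of the whole space.\<close>

lemma card_hyperplane:
  fixes H :: "('a::{field,finite} ^ 'm::finite) set"
  assumes H: "H \<in> pg_hyperplanes" and n: "CARD('m) = n + 1" and p: "p \<notin> H"
  shows "card H = CARD('a) ^ n"
proof -
  have sH: "vec.subspace H" using H unfolding pg_hyperplanes_def by auto
  have p0: "p \<noteq> 0" using p sH vec.subspace_0 by auto
  have "inj_mod p H"
    unfolding inj_mod_def vec.span_singleton
  proof (intro ballI impI notI)
    fix x y assume xy: "x \<in> H" "y \<in> H" "x \<noteq> y" "x - y \<in> range (\<lambda>k. k *s p)"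
    then obtain c where c: "x - y = c *s p" by blast
    moreover have "x - y \<in> H" using xy sH vec.subspace_diff by blast
    ultimately show False using xy(3) scale_mem_subspace_iff[OF sH p, of c] by simp
  qed
  then have inj: "inj_on (\<lambda>(x, c). x + c *s p) (H \<times> UNIV)" using inj_on_inj_mod[OF p0] by blast
  have "(\<lambda>(x, c). x + c *s p) ` (H \<times> UNIV) = UNIV"
    using hyperplane_complement[OF H p] by (auto simp: image_iff)
  with inj have "CARD('a ^ 'm) = card (H \<times> (UNIV :: 'a set))"
    by (metis card_image)
  then have "CARD('a) ^ (n + 1) = card H * CARD('a)"
    using n by (simp add: card_cartesian_product)
  then show ?thesis by simp
qed

text \<open>A vector spanning an affine point has nonzero \<open>p\<close>-component, which can be
  scaled to 1. This is the identification of affine points with vectors of \<open>H\<close>.\<close>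

lemma affine_points_eq_image:
  fixes H :: "('a::field ^ 'm::finite) set"
  assumes H: "H \<in> pg_hyperplanes" and p: "p \<notin> H"
  shows "affine_points H = (\<lambda>x. vec.span {p + x}) ` H"
proof (intro set_eqI iffI)
  have sH: "vec.subspace H" using H unfolding pg_hyperplanes_def by auto
  fix P assume "P \<in> affine_points H"
  then obtain v where v: "v \<notin> H" "P = vec.span {v}"
    unfolding affine_points_def pg_points_iff using span_singleton_subset_iff[OF sH] by auto
  obtain x c where x: "x \<in> H" "v = x + c *s p" using hyperplane_complement[OF H p] by blast
  then have c: "c \<noteq> 0" using v(1) by auto
  then have "v = c *s (p + inverse c *s x)"
    by (simp add: x(2) vector_add_ldistrib vector_smult_assoc add.commute)
  then have "P = vec.span {p + inverse c *s x}"
    using v(2) span_singleton_scale[OF c] by (simp only:)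
  moreover have "inverse c *s x \<in> H" using sH x(1) by (rule vec.subspace_scale)
  ultimately show "P \<in> (\<lambda>x. vec.span {p + x}) ` H" by blast
next
  have sH: "vec.subspace H" using H unfolding pg_hyperplanes_def by auto
  fix P assume "P \<in> (\<lambda>x. vec.span {p + x}) ` H"
  then obtain x where x: "x \<in> H" "P = vec.span {p + x}" by blast
  have px: "p + x \<notin> H" using p x(1) vec.subspace_diff[OF sH, of "p + x" x] by auto
  then have "p + x \<noteq> 0" using vec.subspace_0[OF sH] by metis
  with px x(2) show "P \<in> affine_points H"
    unfolding affine_points_def pg_points_iff using span_singleton_subset_iff[OF sH] by auto
qed

lemma inj_on_affine_point:
  assumes sH: "vec.subspace H" and p: "p \<notin> H"
  shows "inj_on (\<lambda>x. vec.span {p + x}) H"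
proof (rule inj_onI)
  fix x y assume xy: "x \<in> H" "y \<in> H" "vec.span {p + x} = vec.span {p + y}"
  then obtain c where c: "p + x = c *s (p + y)"
    using vec.span_base[of "p + x" "{p + x}"] unfolding vec.span_singleton[of "p + y"] by auto
  then have "(1 - c) *s p = c *s y - x" by (simp add: algebra_simps)
  moreover have "c *s y - x \<in> H" using xy sH by (intro vec.subspace_diff vec.subspace_scale)
  ultimately have "c = 1" using scale_mem_subspace_iff[OF sH p, of "1 - c"] by simp
  with c show "x = y" by simp
qed

text \<open>The line joining the points of \<open>p + x\<close> and \<open>p + y\<close> meets
  \<open>H\<close> exactly in the span of \<open>x - y\<close>.\<close>

lemma determined_directions_iff:
  fixes H :: "('a::field ^ 'm::finite) set"
  assumes sH: "vec.subspace H" and p: "p \<notin> H" and X: "X \<subseteq> H" and d: "d \<in> H" "d \<noteq> 0"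
  shows "vec.span {d} \<in> determined_directions H ((\<lambda>x. vec.span {p + x}) ` X) \<longleftrightarrow> \<not> inj_mod d X"
proof
  assume "vec.span {d} \<in> determined_directions H ((\<lambda>x. vec.span {p + x}) ` X)"
  then obtain l x y where l: "l \<in> pg_lines" "vec.span {d} \<subseteq> l"
    and xy: "x \<in> X" "y \<in> X" "x \<noteq> y" "vec.span {p + x} \<subseteq> l" "vec.span {p + y} \<subseteq> l"
    unfolding determined_directions_def by auto
  have sl: "vec.subspace l" "vec.dim l = 2" using l(1) unfolding pg_lines_def by auto
  have mem: "d \<in> l" "p + x \<in> l" "p + y \<in> l"
    using l(2) xy(4,5) by (simp_all add: span_singleton_subset_iff[OF sl(1)])
  have xyl: "x - y \<in> l" using vec.subspace_diff[OF sl(1) mem(2,3)] by simp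
  have xyH: "x - y \<in> H" "x \<in> H" using X xy sH by (auto intro: vec.subspace_diff)
  \<comment> \<open>Otherwise \<open>p + x\<close>, \<open>x - y\<close> and \<open>d\<close> would
    be three independent vectors in the two-dimensional \<open>l\<close>.\<close>
  have "x - y \<in> vec.span {d}"
  proof (rule ccontr)
    assume n: "x - y \<notin> vec.span {d}"
    have "vec.span {x - y, d} \<subseteq> H" using xyH d sH by (intro vec.span_minimal) auto
    moreover have "p + x \<notin> H" using p xyH(2) vec.subspace_diff[OF sH, of "p + x" x] by auto
    ultimately have "vec.dim {p + x, x - y, d} = 3"
      using n d(2) by (subst vec.dim_insert) (auto simp: vec.dim_insert)
    moreover have "vec.dim {p + x, x - y, d} \<le> vec.dim l"
      by (rule vec.dim_subset) (use mem xyl in auto)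
    ultimately show False using sl(2) by simp
  qed
  with xy show "\<not> inj_mod d X" unfolding inj_mod_def by blast
next
  assume "\<not> inj_mod d X"
  then obtain x y where xy: "x \<in> X" "y \<in> X" "x \<noteq> y" "x - y \<in> vec.span {d}"
    unfolding inj_mod_def by blast
  have xyH: "x \<in> H" "y \<in> H" using X xy by auto
  have px: "p + x \<notin> H" using p xyH(1) vec.subspace_diff[OF sH, of "p + x" x] by auto
  have "vec.span {d} \<subseteq> H" using span_singleton_subset_iff[OF sH] d(1) by simp
  then have l: "vec.span {p + x, d} \<in> pg_lines" using pg_line_span[OF d(2)] px by blast
  have sl: "vec.subspace (vec.span {p + x, d})" by simp
  have mem: "d \<in> vec.span {p + x, d}" "p + x \<in> vec.span {p + x, d}"
    by (auto intro: vec.span_base)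
  have "vec.span {d} \<subseteq> vec.span {p + x, d}" by (rule vec.span_mono) auto
  then have "(p + x) - (x - y) \<in> vec.span {p + x, d}"
    using mem(2) xy(4) vec.span_diff by blast
  then have py: "p + y \<in> vec.span {p + x, d}" by simp
  show "vec.span {d} \<in> determined_directions H ((\<lambda>x. vec.span {p + x}) ` X)"
    unfolding determined_directions_def
  proof (intro CollectI conjI bexI)
    show "vec.span {d} \<in> infinite_points H" using infinite_points_iff[OF sH] d by blast
    show "\<not> vec.span {p + x, d} \<subseteq> H" using px mem by blast
    show "vec.span {p + x} \<noteq> vec.span {p + y}"
      using inj_onD[OF inj_on_affine_point[OF sH p]] xyH xy(3) by blast
  qed (use l xy mem py span_singleton_subset_iff[OF sl] in auto)
qed

theorem theorem3:
  fixes q n :: nat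
    and H :: "('a::{field,finite} ^ 'm::finite) set"
    and U D N :: "('a ^ 'm) set set"
  assumes q: "CARD('a) = q"
    and n: "CARD('m) = n + 1" "n \<ge> 3"
    and not_2_3: "\<not> (q = 2 \<and> n = 3)"
    and H: "H \<in> pg_hyperplanes"
    and U: "U \<subseteq> affine_points H" "card U = q ^ (n - 1) - 2"
    and D: "D = determined_directions H U"
    and N: "N = infinite_points H - D"
  shows "(\<exists>U'. U \<subseteq> U' \<and> U' \<subseteq> affine_points H \<and> card U' = q ^ (n - 1) \<and>
             determined_directions H U' \<subseteq> D) \<or>
         (pg_collinear N \<and> card N \<le> (q + 3) div 2) \<or>
         (\<exists>C. planar_conic C \<and> N \<subseteq> C)"
proof -
  have sH: "vec.subspace H" and dH: "vec.dim H = n"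
    using H n unfolding pg_hyperplanes_def by auto
  have "H \<noteq> UNIV"
  proof
    assume "H = UNIV"
    then have "vec.dim H = CARD('m)" by (simp only: vec_dim_card)
    with dH n(1) show False by linarith
  qed
  then obtain p where p: "p \<notin> H" by blast
  let ?pt = "\<lambda>x. vec.span {p + x}"
  have cH: "card H = CARD('a) ^ n" by (rule card_hyperplane[OF H n(1) p])
  have inj: "inj_on ?pt H" by (rule inj_on_affine_point[OF sH p])
  obtain X where X: "X \<subseteq> H" "U = ?pt ` X"
    using U(1) unfolding affine_points_eq_image[OF H p] by (auto simp: subset_image_iff)
  have "card X = card U"
    unfolding X(2) using inj X(1) by (metis card_image inj_on_subset)
  \<comment> \<open>Guards the truncated subtraction in the cardinality of \<open>U\<close>.\<close>
  moreover have "2 \<le> q ^ (n - 1)"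
  proof -
    have "card {0, 1 :: 'a} \<le> CARD('a)" by (rule card_mono) auto
    then have "2 \<le> q" using q by simp
    also have "q \<le> q ^ (n - 1)" using n(2) \<open>2 \<le> q\<close> by (intro self_le_power) auto
    finally show ?thesis .
  qed
  ultimately have cX: "card X + 2 = CARD('a) ^ (n - 1)" using U(2) q by simp
  have det: "vec.span {d} \<in> determined_directions H (?pt ` Y) \<longleftrightarrow> \<not> inj_mod d Y"
    if "Y \<subseteq> H" "d \<in> H" "d \<noteq> 0" for Y d
    using determined_directions_iff[OF sH p that] .
  have N_iff: "P \<in> N \<longleftrightarrow> (\<exists>d\<in>H. d \<noteq> 0 \<and> inj_mod d X \<and> P = vec.span {d})" for P
    unfolding N D X(2) using infinite_points_iff[OF sH] det[OF X(1)] by auto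
  show ?thesis
  proof (cases "N = {}")
    case True
    \<comment> \<open>Without a non-determined \<open>t0\<close> the trichotomy has no starting
      point; the empty set is collinear as soon as some line exists.\<close>
    have "\<not> H \<subseteq> vec.span {}"
    proof
      assume "H \<subseteq> vec.span {}"
      then have "vec.dim H \<le> vec.dim (vec.span {} :: ('a ^ 'm) set)" by (rule vec.dim_subset)
      then show False using dH n(2) by simp
    qed
    then obtain d where d: "d \<in> H" "d \<noteq> 0" by auto
    have "vec.span {d} \<subseteq> H" using span_singleton_subset_iff[OF sH] d(1) by simp
    then have "vec.span {p, d} \<in> pg_lines" using pg_line_span[OF d(2)] p by blast
    then have "pg_collinear N" unfolding pg_collinear_def True by blast
    moreover have "card N \<le> (q + 3) div 2" by (simp add: True)
    ultimately show ?thesis by blast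
  next
    case False
    then obtain P where "P \<in> N" by blast
    then obtain t0 where t0: "t0 \<in> H" "t0 \<noteq> 0" "inj_mod t0 X" using N_iff[of P] by blast
    have n23: "\<not> (CARD('a) = 2 \<and> n = 3)" using not_2_3 q by simp
    show ?thesis
    proof (rule undetermined_trichotomy[OF sH cH n(2) n23 X(1) cX t0])
      fix X' assume X': "X \<subseteq> X'" "X' \<subseteq> H" "card X' = CARD('a) ^ (n - 1)"
        "\<And>t. t \<in> H \<Longrightarrow> t \<noteq> 0 \<Longrightarrow> inj_mod t X \<Longrightarrow> inj_mod t X'"
      have "card (?pt ` X') = q ^ (n - 1)"
        using X'(2,3) inj q by (metis card_image inj_on_subset)
      moreover have "determined_directions H (?pt ` X') \<subseteq> D"
      proof
        fix P assume P: "P \<in> determined_directions H (?pt ` X')"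
        then have "P \<in> infinite_points H" unfolding determined_directions_def by blast
        then obtain d where d: "d \<in> H" "d \<noteq> 0" "P = vec.span {d}"
          using infinite_points_iff[OF sH] by blast
        with P have "\<not> inj_mod d X'" using det[OF X'(2) d(1,2)] by simp
        then have "\<not> inj_mod d X" using X'(4) d(1,2) by blast
        then show "P \<in> D" using det[OF X(1) d(1,2)] d(3) unfolding D X(2) by simp
      qed
      moreover have "U \<subseteq> ?pt ` X'" "?pt ` X' \<subseteq> affine_points H"
        using X'(1,2) unfolding X(2) affine_points_eq_image[OF H p] by auto
      ultimately show ?thesis by blast
    next
      fix s M assume s: "s \<notin> vec.span {t0}" and M: "2 * card M + 1 \<le> CARD('a)"
        and dir: "\<And>t. t \<in> H \<Longrightarrow> t \<noteq> 0 \<Longrightarrow> inj_mod t X \<Longrightarrow>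
          vec.span {t} = vec.span {t0} \<or> (\<exists>m\<in>M. vec.span {t} = vec.span {s - m *s t0})"
      let ?B = "insert (vec.span {t0}) ((\<lambda>m. vec.span {s - m *s t0}) ` M)"
      have NB: "N \<subseteq> ?B"
      proof
        fix P assume "P \<in> N"
        then obtain t where t: "t \<in> H" "t \<noteq> 0" "inj_mod t X" "P = vec.span {t}"
          using N_iff[of P] by blast
        then show "P \<in> ?B" using dir[OF t(1,2,3)] by blast
      qed
      have "card N \<le> card ?B" by (rule card_mono[OF _ NB]) simp
      also have "\<dots> \<le> Suc (card M)"
        using card_image_le[of M "\<lambda>m. vec.span {s - m *s t0}"] by (simp add: card_insert_if)
      \<comment> \<open>From 2 |M| + 1 <= q follows |N| <= |M| + 1 <= (q + 1) / 2, which is within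
        the bound.\<close>
      finally have "card N \<le> (q + 3) div 2" using M q by simp
      moreover have "pg_collinear N"
        unfolding pg_collinear_def
      proof (intro bexI ballI)
        show "vec.span {s, t0} \<in> pg_lines" by (rule pg_line_span[OF t0(2) s])
        have "s \<in> vec.span {s, t0}" and t: "t0 \<in> vec.span {s, t0}"
          by (auto intro: vec.span_base)
        then have m: "s - m *s t0 \<in> vec.span {s, t0}" for m
          by (intro vec.span_diff vec.span_scale)
        fix P assume "P \<in> N"
        with NB have "P \<in> ?B" by blast
        then show "P \<subseteq> vec.span {s, t0}"
          by (elim insertE imageE) (simp_all only: span_singleton_subset_iff[OF vec.subspace_span] t m)
      qed
      ultimately show ?thesis by blast
    next
      fix s w assume sw: "s \<notin> vec.span {t0}" "w \<notin> vec.span {s, t0}"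
        and dir: "\<And>t. t \<in> H \<Longrightarrow> t \<noteq> 0 \<Longrightarrow> inj_mod t X \<Longrightarrow>
          \<exists>a b c. t = a *s s + b *s t0 + c *s w \<and> a\<^sup>2 = b * c"
      obtain C where C: "planar_conic C"
        "\<And>v a b c. v \<noteq> 0 \<Longrightarrow> v = a *s s + b *s t0 + c *s w \<Longrightarrow> a\<^sup>2 = b * c \<Longrightarrow> vec.span {v} \<in> C"
        by (rule planar_conic_coordinates[OF t0(2) sw]) blast
      have "N \<subseteq> C"
      proof
        fix P assume "P \<in> N"
        then obtain t where t: "t \<in> H" "t \<noteq> 0" "inj_mod t X" "P = vec.span {t}"
          using N_iff[of P] by blast
        then show "P \<in> C" using dir[OF t(1,2,3)] C(2)[OF t(2)] by blast
      qed
      with C(1) show ?thesis by blast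
    qed
  qed
qed

end
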